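(* Let $\tau>0$ and $a,c\in\mathbb{R}$ with $a+c>0$. Let $d\in\{0,1,2,\dots\}$, $c>s_1>\dots>s_d>s_{d+1}>-a$, and $0=t_0<t_1<\dots<t_d<t_{d+1}=\tau$. Then $$\int_0^\infty \mathbb{E}\left[\exp\left(-\sum_{k=1}^{d+1}(t_k-t_{k-1})\mathbb{T}_{s_k}\right)\,\middle|\,\mathbb{T}_{s_{d+1}}=x\right]\widetilde{\mathfrak p}_{s_{d+1}}(x)\,dx=\mathbb{E}\left[\exp\left(\sum_{k=1}^{d+1}s_k\,(Y_{t_k}-Y_{t_{k-1}})\right)\right],$$ where for $-a<s<c$, $$\widetilde{\mathfrak p}_s(x)=\frac{2^{a+c}}{16\pi\, C^{(\tau)}_{a,c}}\;\frac{\left|\Gamma\left(\frac{a+s+i\sqrt x}{2}\right)\Gamma\left(\frac{c-s+i\sqrt x}{2}\right)\right|^2}{\sqrt x\,|\Gamma(i\sqrt x)|^2},\qquad x>0 .$$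
   Context: $K_{iu}(x)=\int_0^\infty e^{-x\cosh w}\cos(uw)\,dw$ ($u\in\mathbb{R}$, $x>0$) is the modified Bessel function, $\mu(du)=\frac{2}{\pi}\frac{du}{|\Gamma(iu)|^2}$ on $(0,\infty)$, and $p_t(x,y)=\int_0^\infty e^{-tu^2}K_{iu}(e^x)K_{iu}(e^y)\,\mu(du)$ for $x,y\in\mathbb{R}$, $t>0$. Set $C^{(\tau)}_{a,c}=\int_{\mathbb{R}}\int_{\mathbb{R}}e^{ax+cy}p_\tau(x,y)\,dx\,dy$, which is finite when $a+c>0$. $(Y_t)_{t\in[0,\tau]}$ is the Markov process (which exists when $a+c>0$) such that for all $d\ge0$ and $0=t_0<t_1<\dots<t_{d+1}=\tau$ the vector $(Y_{t_0},\dots,Y_{t_{d+1}})$ has density $\frac{1}{C^{(\tau)}_{a,c}}e^{cx_0+ax_{d+1}}\prod_{k=1}^{d+1}p_{t_k-t_{k-1}}(x_{k-1},x_k)$. $(\mathbb{T}_s)_{s\in(-a,c)}$ is the Markov process with state space $(0,\infty)$ and transition probabilities, for $-a<s<t<c$ and $x>0$, $$\mathbb{P}(\mathbb{T}_t\in dy\mid \mathbb{T}_s=x)=\frac{\left|\Gamma\left(\frac{c-t+i\sqrt y}{2}\right)\Gamma\left(\frac{t-s+i(\sqrt x+\sqrt y)}{2}\right)\Gamma\left(\frac{t-s+i(\sqrt x-\sqrt y)}{2}\right)\right|^2}{8\pi\sqrt y\;\Gamma(t-s)\left|\Gamma\left(\frac{c-s+i\sqrt x}{2}\right)\Gamma(i\sqrt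 y)\right|^2}\,1_{\{y>0\}}\,dy .$$ The conditional expectation given $\mathbb{T}_{s_{d+1}}=x$ is with respect to the law of $(\mathbb{T}_{s_{d+1}},\mathbb{T}_{s_d},\dots,\mathbb{T}_{s_1})$ started from $x$ at time $s_{d+1}$ (the smallest time) and evolving with these transition probabilities. *)

theory Defs
  imports "HOL-Probability.Probability"
begin

definition besselK_imag :: "real \<Rightarrow> real \<Rightarrow> real" where
  "besselK_imag u x = (LBINT w:{0<..}. exp (- x * cosh w) * cos (u * w))"

definition spectral_measure :: "real measure" where
  "spectral_measure =
     density lborel (\<lambda>u. ennreal (indicator {0<..} u * (2 / pi) / (cmod (Gamma (\<i> * u)))\<^sup>2))"

definition p_heat :: "real \<Rightarrow> real \<Rightarrow> real \<Rightarrow> real" where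
  "p_heat t x y =
     (\<integral>u. exp (- t * u\<^sup>2) * besselK_imag u (exp x) * besselK_imag u (exp y) \<partial>spectral_measure)"

definition C_norm :: "real \<Rightarrow> real \<Rightarrow> real \<Rightarrow> real" where
  "C_norm \<tau> a c = (LBINT y. LBINT x. exp (a * x + c * y) * p_heat \<tau> x y)"

text \<open>
  The random element \<open>X\<close> has the real-valued density \<open>f\<close> with respect to \<open>N\<close>. The coercion
  \<open>ennreal\<close> truncates negative values to \<open>0\<close>, so the nonnegativity that belongs to the notion
  of a density is stated separately.
\<close>
definition has_real_density ::
    "'w measure \<Rightarrow> 'b measure \<Rightarrow> ('w \<Rightarrow> 'b) \<Rightarrow> ('b \<Rightarrow> real) \<Rightarrow> bool" where
  "has_real_density M N X f \<longleftrightarrow>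
     (AE x in N. 0 \<le> f x) \<and> distributed M N X (\<lambda>x. ennreal (f x))"

text \<open>
  \<open>(Y t)\<close>, \<open>t \<in> [0,\<tau>]\<close>, is a version of the process with the prescribed finite-dimensional
  densities. These determine its law, and their product form is the Markov property.
\<close>
definition Y_process ::
    "real \<Rightarrow> real \<Rightarrow> real \<Rightarrow> 'w measure \<Rightarrow> (real \<Rightarrow> 'w \<Rightarrow> real) \<Rightarrow> bool" where
  "Y_process \<tau> a c M Y \<longleftrightarrow>
     prob_space M \<and>
     (\<forall>r\<in>{0..\<tau>}. Y r \<in> borel_measurable M) \<and>
     (\<forall>(d::nat) (t::nat \<Rightarrow> real).
        t 0 = 0 \<and> (\<forall>k\<in>{1..d+1}. t (k - 1) < t k) \<and> t (d + 1) = \<tau> \<longrightarrow>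
        has_real_density M (PiM {0..d+1} (\<lambda>_. lborel)) (\<lambda>\<omega>. \<lambda>k\<in>{0..d+1}. Y (t k) \<omega>)
          (\<lambda>x. 1 / C_norm \<tau> a c * exp (c * x 0 + a * x (d + 1)) *
               (\<Prod>k=1..d+1. p_heat (t k - t (k - 1)) (x (k - 1)) (x k))))"

text \<open>
  Density at \<open>y\<close> of the transition probability of the process \<open>\<bbbT>\<close> from the state \<open>x > 0\<close> at
  time \<open>s\<close> to time \<open>t\<close>, for \<open>-a < s < t < c\<close>. The expression does not involve \<open>a\<close>.
\<close>
definition T_density :: "real \<Rightarrow> real \<Rightarrow> real \<Rightarrow> real \<Rightarrow> real \<Rightarrow> real" where
  "T_density c s t x y =
     (if y > 0 then
        (cmod (Gamma ((c - t + \<i> * sqrt y) / 2) *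
               Gamma ((t - s + \<i> * (sqrt x + sqrt y)) / 2) *
               Gamma ((t - s + \<i> * (sqrt x - sqrt y)) / 2)))\<^sup>2 /
        (8 * pi * sqrt y * Gamma (t - s) *
         (cmod (Gamma ((c - s + \<i> * sqrt x) / 2) * Gamma (\<i> * sqrt y)))\<^sup>2)
      else 0)"

text \<open>
  Law of \<open>(\<bbbT>\<^bsub>s k\<^esub>)\<close>, \<open>k \<in> {1..d+1}\<close>, for the process started from \<open>x\<close> at the smallest time
  \<open>s (d+1)\<close>. Since \<open>s\<close> is decreasing, the evolution runs from index \<open>k + 1\<close> to index \<open>k\<close>.
  The coordinates \<open>1..d\<close> have as joint density the product of the transition densities, and
  coordinate \<open>d + 1\<close> is the constant \<open>x\<close>.
\<close>
definition T_law :: "real \<Rightarrow> nat \<Rightarrow> (nat \<Rightarrow> real) \<Rightarrow> real \<Rightarrow> (nat \<Rightarrow> real) measure" where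
  "T_law c d s x =
     distr
       (density (PiM {1..d} (\<lambda>_. lborel))
          (\<lambda>y. ennreal (let z = y(d + 1 := x) in
             \<Prod>k=1..d. T_density c (s (k + 1)) (s k) (z (k + 1)) (z k))))
       (PiM {1..d+1} (\<lambda>_. borel))
       (\<lambda>y. y(d + 1 := x))"

definition p_tilde :: "real \<Rightarrow> real \<Rightarrow> real \<Rightarrow> real \<Rightarrow> real \<Rightarrow> real" where
  "p_tilde \<tau> a c s x =
     2 powr (a + c) / (16 * pi * C_norm \<tau> a c) *
     ((cmod (Gamma ((a + s + \<i> * sqrt x) / 2) * Gamma ((c - s + \<i> * sqrt x) / 2)))\<^sup>2 /
      (sqrt x * (cmod (Gamma (\<i> * sqrt x)))\<^sup>2))"

end

theory Submission
  imports Defs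
begin

text \<open>
  Both sides are the two orders of integration of one absolutely convergent integral. In the
  variable \<open>z = u\<^sup>2\<close> each heat kernel is a mixture of products \<open>K\<^bsub>i\<surd>z\<^esub>(e\<^sup>x) K\<^bsub>i\<surd>z\<^esub>(e\<^sup>y)\<close>; inserting this
  into the density of \<open>Y\<close>, summing \<open>\<Sum> s\<^sub>k (x\<^sub>k - x\<^sub>k\<^sub>-\<^sub>1)\<close> by parts and integrating out the \<open>x\<^sub>k\<close> first
  leaves the Mellin transforms of \<open>K\<^bsub>iu\<^esub>\<close> (at the two ends) and of \<open>K\<^bsub>iu\<^esub> K\<^bsub>iv\<^esub>\<close> (inside), which are the
  Gamma factors of the transition densities up to a telescoping quotient. Fubini is justified by
  \<open>\<bar>K\<^bsub>iu\<^esub>\<bar> \<le> K\<^sub>0\<close>, which separates the variables. Both Mellin transforms follow from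
  \<open>\<Gamma>(p) = \<integral> exp (p x - e\<^sup>x) dx\<close> by rotating coordinates in products of two such integrals.
\<close>

section \<open>Change of variables and Fubini\<close>

text \<open>The substitution theorem on the line speaks of \<open>absolutely_integrable_on\<close>,
  whereas the Fubini arguments run over \<open>lborel\<close>. For Borel functions the two agree
  because completing the measure changes no integral. The conjunction has the shape in which the
  substitution theorem rewrites.\<close>

lemma absolutely_integrable_on_lborel:
  fixes f :: "'a::euclidean_space \<Rightarrow> 'b::euclidean_space"
  assumes "set_borel_measurable borel U f"
  shows "f absolutely_integrable_on U \<and> integral U f = b \<longleftrightarrow>
      has_bochner_integral lborel (\<lambda>x. indicator U x *\<^sub>R f x) b"
proof -
  have m: "(\<lambda>x. indicator U x *\<^sub>R f x) \<in> borel_measurable lborel"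
    using assms by (simp add: set_borel_measurable_def)
  have 1: "f absolutely_integrable_on U \<longleftrightarrow> integrable lborel (\<lambda>x. indicator U x *\<^sub>R f x)"
    using integrable_completion[OF m] by (simp add: set_integrable_def)
  have 2: "integral U f = (\<integral>x. indicator U x *\<^sub>R f x \<partial>lborel)" if "f absolutely_integrable_on U"
    using set_lebesgue_integral_eq_integral(2)[OF that] integral_completion[OF m]
    by (simp add: set_lebesgue_integral_def)
  show ?thesis using 1 2 by (auto simp: has_bochner_integral_iff)
qed

text \<open>Euler's integral with \<open>t = exp x\<close>; the Jacobian raises the exponent
  \<open>z - 1\<close> to \<open>z\<close>. In this additive variable, products of two Gamma
  integrals admit linear changes of coordinates.\<close>

lemma has_bochner_integral_Gamma_exp:
  assumes z: "Re z > 0"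
  shows "has_bochner_integral lborel (\<lambda>x::real. exp (z * of_real x - of_real (exp x))) (Gamma z)"
proof -
  let ?f = "\<lambda>t. complex_of_real t powr (z - 1) / of_real (exp t)"
  have ran: "range (exp :: real \<Rightarrow> real) = {0<..}"
    using exp_total by (auto simp: image_iff)
  have "?f absolutely_integrable_on {0<..} \<and> integral {0<..} ?f = Gamma z"
    using absolutely_integrable_Gamma_integral'[OF z] Gamma_integral_complex'[OF z]
    by (simp add: integral_unique)
  then have "(\<lambda>x. \<bar>exp x\<bar> *\<^sub>R ?f (exp x)) absolutely_integrable_on UNIV \<and>
      integral UNIV (\<lambda>x. \<bar>exp x\<bar> *\<^sub>R ?f (exp x)) = Gamma z"
    by (subst has_absolute_integral_change_of_variables_real)
       (auto simp: ran inj_on_def intro!: derivative_eq_intros)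
  moreover have "\<bar>exp x\<bar> *\<^sub>R ?f (exp x) = exp (z * of_real x - of_real (exp x))" for x :: real
  proof -
    have "\<bar>exp x\<bar> *\<^sub>R ?f (exp x) = exp (of_real x) * exp ((z - 1) * of_real x) / exp (of_real (exp x))"
      by (simp add: powr_def scaleR_conv_of_real Ln_of_real exp_of_real)
    also have "\<dots> = exp (of_real x + (z - 1) * of_real x - of_real (exp x))"
      by (simp only: exp_add exp_diff)
    also have "of_real x + (z - 1) * of_real x - of_real (exp x) = z * of_real x - of_real (exp x)"
      by (simp add: algebra_simps)
    finally show ?thesis .
  qed
  ultimately show ?thesis
    by (subst (asm) absolutely_integrable_on_lborel) (auto simp: set_borel_measurable_def)
qed

lemma has_bochner_integral_Gamma_exp_scaled:
  fixes \<alpha> b :: real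
  assumes \<alpha>: "\<alpha> > 0" and b: "b > 0"
  shows "has_bochner_integral lborel (\<lambda>r. exp (\<alpha> * r - b * exp r)) (Gamma \<alpha> * b powr (- \<alpha>))"
proof -
  have "has_bochner_integral lborel (\<lambda>x::real. complex_of_real (exp (\<alpha> * x - exp x))) (complex_of_real (Gamma \<alpha>))"
    using has_bochner_integral_Gamma_exp[of "of_real \<alpha>"] \<alpha>
    by (simp add: Gamma_complex_of_real exp_of_real[symmetric])
  then have "has_bochner_integral lborel (\<lambda>x::real. exp (\<alpha> * x - exp x)) (Gamma \<alpha>)"
    by (auto simp: has_bochner_integral_iff complex_of_real_integrable_eq)
  \<comment> \<open>Translation by \<open>ln b\<close> turns \<open>exp x\<close> into
    \<open>b * exp x\<close>; the surplus factor \<open>b powr \<alpha>\<close> is divided out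
    afterwards.\<close>
  then have "has_bochner_integral lborel (\<lambda>x::real. exp (\<alpha> * (ln b + 1 * x) - exp (ln b + 1 * x))) (Gamma \<alpha>)"
    using lborel_has_bochner_integral_real_affine_iff[of 1 "\<lambda>x. exp (\<alpha> * x - exp x)" "Gamma \<alpha>" "ln b"] by simp
  then have "has_bochner_integral lborel (\<lambda>x. b powr (-\<alpha>) * exp (\<alpha> * (ln b + 1 * x) - exp (ln b + 1 * x))) (b powr (-\<alpha>) * Gamma \<alpha>)"
    by (intro has_bochner_integral_mult_right)
  moreover have "b powr (-\<alpha>) * exp (\<alpha> * (ln b + 1 * x) - exp (ln b + 1 * x)) = exp (\<alpha> * x - b * exp x)" for x
    using b by (simp add: powr_def exp_add mult_exp_exp ring_distribs)
  ultimately show ?thesis by (simp add: mult.commute)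
qed

text \<open>The Jacobian is \<open>2 * k\<^sup>2\<close> in absolute value. It arises from two
  affine substitutions on the line: \<open>x = k * (p + q)\<close> at fixed \<open>q\<close> gives
  \<open>1 / k\<close>, and, after exchanging the order, \<open>y = x - 2 * k * q\<close> at fixed
  \<open>x\<close> gives \<open>1 / (2 * k)\<close>.\<close>

lemma distr_lborel_rotation:
  fixes k :: real
  assumes k: "k > 0"
  shows "distr (lborel \<Otimes>\<^sub>M lborel) (lborel \<Otimes>\<^sub>M lborel) (\<lambda>(p, q). (k * (p + q), k * (p - q))) =
    density (lborel \<Otimes>\<^sub>M lborel :: (real \<times> real) measure) (\<lambda>_. ennreal (1 / (2 * k\<^sup>2)))"
proof (rule measure_eqI)
  let ?R = "\<lambda>(p, q). (k * (p + q), k * (p - q))"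
  fix B assume "B \<in> sets (distr (lborel \<Otimes>\<^sub>M lborel) (lborel \<Otimes>\<^sub>M lborel) ?R)"
  then have B[measurable]: "B \<in> sets (borel \<Otimes>\<^sub>M borel)"
    by (simp cong: sets_pair_measure_cong)
  let ?f = "\<lambda>x y. indicator B (x, y) :: ennreal"
  have "emeasure (distr (lborel \<Otimes>\<^sub>M lborel) (lborel \<Otimes>\<^sub>M lborel) ?R) B =
      (\<integral>\<^sup>+z. indicator B (?R z) \<partial>(lborel \<Otimes>\<^sub>M lborel))"
    by (subst nn_integral_indicator[symmetric], simp, subst nn_integral_distr) auto
  also have "\<dots> = (\<integral>\<^sup>+q. \<integral>\<^sup>+p. ?f (k * (p + q)) (k * (p - q)) \<partial>lborel \<partial>lborel)"
    by (subst lborel_pair.nn_integral_snd[symmetric]) (auto simp: case_prod_beta)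
  also have "\<dots> = (\<integral>\<^sup>+q. ennreal (1 / k) * \<integral>\<^sup>+x. ?f x (x - 2 * k * q) \<partial>lborel \<partial>lborel)"
  proof (rule nn_integral_cong)
    fix q :: real
    have "(\<integral>\<^sup>+p. ?f (k * (p + q)) (k * (p - q)) \<partial>lborel) =
      ennreal \<bar>1 / k\<bar> * (\<integral>\<^sup>+x. ?f (k * ((- q + 1 / k * x) + q)) (k * ((- q + 1 / k * x) - q)) \<partial>lborel)"
      using k by (intro nn_integral_real_affine) auto
    also have "\<dots> = ennreal (1 / k) * (\<integral>\<^sup>+x. ?f x (x - 2 * k * q) \<partial>lborel)"
      using k by (auto intro!: arg_cong2[where f="(*)"] nn_integral_cong arg_cong[where f="indicator B"] simp: field_simps)
    finally show "(\<integral>\<^sup>+p. ?f (k * (p + q)) (k * (p - q)) \<partial>lborel) =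
      ennreal (1 / k) * (\<integral>\<^sup>+x. ?f x (x - 2 * k * q) \<partial>lborel)" .
  qed
  also have "\<dots> = ennreal (1 / k) * (\<integral>\<^sup>+q. \<integral>\<^sup>+x. ?f x (x - 2 * k * q) \<partial>lborel \<partial>lborel)"
    by (subst nn_integral_cmult) auto
  also have "(\<integral>\<^sup>+q. \<integral>\<^sup>+x. ?f x (x - 2 * k * q) \<partial>lborel \<partial>lborel) =
      (\<integral>\<^sup>+x. \<integral>\<^sup>+q. ?f x (x - 2 * k * q) \<partial>lborel \<partial>lborel)"
    by (rule lborel_pair.Fubini') auto
  also have "\<dots> = (\<integral>\<^sup>+x. ennreal (1 / (2 * k)) * \<integral>\<^sup>+y. ?f x y \<partial>lborel \<partial>lborel)"
  proof (rule nn_integral_cong)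
    fix x :: real
    have "(\<integral>\<^sup>+q. ?f x (x - 2 * k * q) \<partial>lborel) =
      ennreal \<bar>- 1 / (2 * k)\<bar> * (\<integral>\<^sup>+y. ?f x (x - 2 * k * (x / (2 * k) + (- 1 / (2 * k)) * y)) \<partial>lborel)"
      using k by (intro nn_integral_real_affine) auto
    also have "\<dots> = ennreal (1 / (2 * k)) * (\<integral>\<^sup>+y. ?f x y \<partial>lborel)"
      using k by (auto intro!: arg_cong2[where f="(*)"] nn_integral_cong arg_cong[where f="indicator B"] simp: field_simps)
    finally show "(\<integral>\<^sup>+q. ?f x (x - 2 * k * q) \<partial>lborel) = ennreal (1 / (2 * k)) * (\<integral>\<^sup>+y. ?f x y \<partial>lborel)" .
  qed
  also have "\<dots> = ennreal (1 / (2 * k)) * (\<integral>\<^sup>+x. \<integral>\<^sup>+y. ?f x y \<partial>lborel \<partial>lborel)"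
    by (subst nn_integral_cmult) auto
  also have "(\<integral>\<^sup>+x. \<integral>\<^sup>+y. ?f x y \<partial>lborel \<partial>lborel) = (\<integral>\<^sup>+z. indicator B z \<partial>(lborel \<Otimes>\<^sub>M lborel))"
    by (subst lborel.nn_integral_fst[symmetric]) auto
  also have "ennreal (1 / k) * (ennreal (1 / (2 * k)) * \<dots>) = ennreal (1 / (2 * k\<^sup>2)) * (\<integral>\<^sup>+z. indicator B z \<partial>(lborel \<Otimes>\<^sub>M lborel))"
    unfolding mult.assoc[symmetric]
    using k by (simp add: ennreal_mult[symmetric] power2_eq_square mult.left_commute[of k 2])
  also have "\<dots> = emeasure (density (lborel \<Otimes>\<^sub>M lborel) (\<lambda>_. ennreal (1 / (2 * k\<^sup>2)))) B"
    by (subst emeasure_density) (auto simp: nn_integral_cmult)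
  finally show "emeasure (distr (lborel \<Otimes>\<^sub>M lborel) (lborel \<Otimes>\<^sub>M lborel) ?R) B =
    emeasure (density (lborel \<Otimes>\<^sub>M lborel) (\<lambda>_. ennreal (1 / (2 * k\<^sup>2)))) B" .
qed simp

lemma has_bochner_integral_rotation:
  fixes f :: "real \<times> real \<Rightarrow> 'b::{banach, second_countable_topology}"
  assumes k: "k > 0" and f: "has_bochner_integral (lborel \<Otimes>\<^sub>M lborel) f v"
  shows "has_bochner_integral (lborel \<Otimes>\<^sub>M lborel) (\<lambda>(p, q). f (k * (p + q), k * (p - q)))
      ((1 / (2 * k\<^sup>2)) *\<^sub>R v)"
proof -
  have [measurable]: "f \<in> borel_measurable (lborel \<Otimes>\<^sub>M lborel)"
    using f by (auto simp: has_bochner_integral_iff)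
  let ?R = "\<lambda>(p, q). (k * (p + q), k * (p - q))"
  have "has_bochner_integral (density (lborel \<Otimes>\<^sub>M lborel) (\<lambda>_. ennreal (1 / (2 * k\<^sup>2)))) f ((1 / (2 * k\<^sup>2)) *\<^sub>R v)"
    using has_bochner_integral_scaleR_right[OF f, of "1 / (2 * k\<^sup>2)"]
    by (intro has_bochner_integral_density) auto
  then have "has_bochner_integral (lborel \<Otimes>\<^sub>M lborel) (\<lambda>z. f (?R z)) ((1 / (2 * k\<^sup>2)) *\<^sub>R v)"
    unfolding distr_lborel_rotation[OF k, symmetric]
    by (auto simp: has_bochner_integral_iff integrable_distr_eq integral_distr)
  then show ?thesis by (simp add: case_prod_beta')
qed

section \<open>Product integrands and iterated integrals\<close>

lemma has_bochner_integral_pair_mult: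
  fixes f :: "'a \<Rightarrow> 'c::{real_normed_field, banach, second_countable_topology}"
  assumes "pair_sigma_finite M1 M2"
    and f: "has_bochner_integral M1 f a" and g: "has_bochner_integral M2 g b"
  shows "has_bochner_integral (M1 \<Otimes>\<^sub>M M2) (\<lambda>(x, y). f x * g y) (a * b)"
proof -
  interpret pair_sigma_finite M1 M2 by fact
  have f': "integrable M1 f" and g': "integrable M2 g" and [measurable]: "f \<in> borel_measurable M1" "g \<in> borel_measurable M2"
    using f g by (auto simp: has_bochner_integral_iff)
  have i: "integrable (M1 \<Otimes>\<^sub>M M2) (\<lambda>(x, y). f x * g y)"
    by (rule Fubini_integrable) (use f' g' in \<open>auto simp: abs_mult norm_mult\<close>)
  show ?thesis
    using integral_fst[OF i] i f g by (simp add: has_bochner_integral_iff)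
qed

text \<open>Serves to integrate out one variable when the inner integrals are known in closed form.
  Used on the same integrand as \<open>has_bochner_integral_snd\<close>, it equates the two iterated
  integrals, as both inherit the joint value \<open>v\<close>.\<close>

lemma has_bochner_integral_fst:
  fixes f :: "'a \<Rightarrow> 'b \<Rightarrow> 'c::{banach, second_countable_topology}"
  assumes "pair_sigma_finite M1 M2"
    and f: "has_bochner_integral (M1 \<Otimes>\<^sub>M M2) (\<lambda>(x, y). f x y) v"
    and g: "\<And>x. x \<in> space M1 \<Longrightarrow> has_bochner_integral M2 (f x) (g x)"
  shows "has_bochner_integral M1 g v"
proof -
  interpret pair_sigma_finite M1 M2 by fact
  have i: "integrable (M1 \<Otimes>\<^sub>M M2) (\<lambda>(x, y). f x y)" and v: "(\<integral>(x, y). f x y \<partial>(M1 \<Otimes>\<^sub>M M2)) = v"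
    using f by (auto simp: has_bochner_integral_iff)
  have "has_bochner_integral M1 (\<lambda>x. \<integral>y. f x y \<partial>M2) v"
    using integral_fst[OF i] integrable_fst[OF i] v by (simp add: has_bochner_integral_iff)
  then show ?thesis
    using g by (subst has_bochner_integral_cong[OF refl _ refl, symmetric]) (auto simp: has_bochner_integral_iff)
qed

lemma has_bochner_integral_snd:
  fixes f :: "'a \<Rightarrow> 'b \<Rightarrow> 'c::{banach, second_countable_topology}"
  assumes "pair_sigma_finite M1 M2"
    and f: "has_bochner_integral (M1 \<Otimes>\<^sub>M M2) (\<lambda>(x, y). f x y) v"
    and g: "\<And>y. y \<in> space M2 \<Longrightarrow> has_bochner_integral M1 (\<lambda>x. f x y) (g y)"
  shows "has_bochner_integral M2 g v"
proof -
  interpret pair_sigma_finite M1 M2 by fact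
  have i: "integrable (M1 \<Otimes>\<^sub>M M2) (\<lambda>(x, y). f x y)" and v: "(\<integral>(x, y). f x y \<partial>(M1 \<Otimes>\<^sub>M M2)) = v"
    using f by (auto simp: has_bochner_integral_iff)
  have "has_bochner_integral M2 (\<lambda>y. \<integral>x. f x y \<partial>M1) v"
    using integral_snd[OF i] integrable_snd[OF i] v by (simp add: has_bochner_integral_iff)
  then show ?thesis
    using g by (subst has_bochner_integral_cong[OF refl _ refl, symmetric]) (auto simp: has_bochner_integral_iff)
qed

lemma has_bochner_integral_complex_of_real:
  "has_bochner_integral M (\<lambda>x. complex_of_real (f x)) (of_real v) \<longleftrightarrow> has_bochner_integral M f v"
  by (auto simp: has_bochner_integral_iff complex_of_real_integrable_eq)

section \<open>Mellin transforms of the Bessel functions\<close>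

lemma besselK_imag_measurable [measurable (raw)]:
  assumes [measurable]: "f \<in> borel_measurable M" "g \<in> borel_measurable M"
  shows "(\<lambda>x. besselK_imag (f x) (g x)) \<in> borel_measurable M"
proof -
  have [measurable]: "(cosh :: real \<Rightarrow> real) \<in> borel_measurable borel"
    by (intro borel_measurable_continuous_onI continuous_intros)
  show ?thesis
    unfolding besselK_imag_def set_lebesgue_integral_def by measurable
qed

text \<open>The integrand lies below a Gaussian, since \<open>cosh\<close> grows at least
  quadratically.\<close>

lemma integrable_exp_cosh:
  fixes x :: real
  assumes x: "x > 0"
  shows "integrable lborel (\<lambda>w. exp (- x * cosh w))"
proof -
  have [measurable]: "(cosh :: real \<Rightarrow> real) \<in> borel_measurable borel"
    by (intro borel_measurable_continuous_onI continuous_intros)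
  have cosh_ge: "w\<^sup>2 / 4 \<le> cosh w" for w :: real
  proof -
    have "1 + \<bar>w\<bar> + \<bar>w\<bar>\<^sup>2 / 2 \<le> exp \<bar>w\<bar>"
      by (rule exp_lower_Taylor_quadratic) simp
    moreover have "exp \<bar>w\<bar> \<le> exp w + exp (- w)"
      by (simp add: abs_if)
    ultimately show ?thesis by (simp add: cosh_field_def)
  qed
  \<comment> \<open>Chosen so that
    \<open>w\<^sup>2 / (2 * \<sigma>\<^sup>2) = x * (w\<^sup>2 / 4)\<close>, which makes the
    comparison function a multiple of a normal density.\<close>
  define \<sigma> where "\<sigma> = sqrt (2 / x)"
  have \<sigma>: "\<sigma> > 0" "\<sigma>\<^sup>2 = 2 / x" using x by (auto simp: \<sigma>_def)
  have "integrable lborel (\<lambda>w. sqrt (2 * pi * \<sigma>\<^sup>2) * normal_density 0 \<sigma> w)"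
    using \<sigma> by (intro integrable_mult_right integrable_normal_density)
  moreover have "sqrt (2 * pi * \<sigma>\<^sup>2) * normal_density 0 \<sigma> w = exp (- x * (w\<^sup>2 / 4))" for w
    using x by (simp add: normal_density_def \<sigma>)
  ultimately have "integrable lborel (\<lambda>w. exp (- x * (w\<^sup>2 / 4)))" by simp
  then show ?thesis
    by (rule Bochner_Integration.integrable_bound) (use x cosh_ge in auto)
qed

text \<open>Pairing \<open>w\<close> with \<open>- w\<close> cancels the odd sine part and doubles
  the cosine part. The exponential form over the whole line is multiplicative, as the products below
  require.\<close>

lemma has_bochner_integral_besselK_imag:
  fixes x u :: real
  assumes x: "x > 0"
  shows "has_bochner_integral lborel (\<lambda>w. exp (\<i> * (u * w) - of_real (x * cosh w)))
    (of_real (2 * besselK_imag u x))"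
proof -
  have [measurable]: "(cosh :: real \<Rightarrow> real) \<in> borel_measurable borel"
    by (intro borel_measurable_continuous_onI continuous_intros)
  define f where "f w = exp (\<i> * of_real (u * w) - of_real (x * cosh w))" for w
  have [measurable]: "f \<in> borel_measurable borel" unfolding f_def by measurable
  have int: "integrable lborel f"
    by (rule Bochner_Integration.integrable_bound[OF integrable_exp_cosh[OF x]]) (auto simp: f_def)
  have intm: "integrable lborel (\<lambda>w. f (- w))"
    using lborel_integrable_real_affine[OF int, of "-1" 0] by simp
  have sum: "f w + f (- w) = of_real (2 * (exp (- x * cosh w) * cos (u * w)))" for w
    by (simp add: f_def complex_eq_iff Re_exp Im_exp)
  have ii: "integrable lborel (\<lambda>w. indicator A w *\<^sub>R g w)"
    if [measurable]: "A \<in> sets borel" and "integrable lborel g" for A and g :: "real \<Rightarrow> complex"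
    using that by (intro integrable_mult_indicator) auto
  have "(\<integral>w. f w \<partial>lborel) = (\<integral>w. indicator {0<..} w *\<^sub>R f w + indicator {..0} w *\<^sub>R f w \<partial>lborel)"
    by (intro Bochner_Integration.integral_cong) (auto split: split_indicator)
  also have "\<dots> = (\<integral>w. indicator {0<..} w *\<^sub>R f w \<partial>lborel) + (\<integral>w. indicator {..0} w *\<^sub>R f w \<partial>lborel)"
    by (intro Bochner_Integration.integral_add ii int) auto
  also have "(\<integral>w. indicator {..0} w *\<^sub>R f w \<partial>lborel) = (\<integral>w. indicator {..0} (- w) *\<^sub>R f (- w) \<partial>lborel)"
    by (subst lborel_integral_real_affine[where c="-1" and t=0]) auto
  \<comment> \<open>Reflection carries \<open>{..0}\<close> to \<open>{0..}\<close>, which differs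
    from \<open>{0<..}\<close> by a null set.\<close>
  also have "\<dots> = (\<integral>w. indicator {0<..} w *\<^sub>R f (- w) \<partial>lborel)"
    by (intro integral_cong_AE AE_I[where N="{0}"]) (auto split: split_indicator)
  also have "(\<integral>w. indicator {0<..} w *\<^sub>R f w \<partial>lborel) + \<dots> =
      (\<integral>w. indicator {0<..} w *\<^sub>R f w + indicator {0<..} w *\<^sub>R f (- w) \<partial>lborel)"
    by (intro Bochner_Integration.integral_add[symmetric] ii int intm) auto
  also have "\<dots> = (\<integral>w. of_real (2 * (indicator {0<..} w * (exp (- x * cosh w) * cos (u * w)))) \<partial>lborel)"
    by (intro Bochner_Integration.integral_cong)
       (auto simp: scaleR_conv_of_real sum simp flip: distrib_left split: split_indicator)
  also have "\<dots> = of_real (2 * besselK_imag u x)"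
    unfolding integral_complex_of_real by (simp add: besselK_imag_def set_lebesgue_integral_def)
  finally show ?thesis using int unfolding has_bochner_integral_iff f_def by blast
qed

lemma besselK_imag_0_nonneg: "besselK_imag 0 x \<ge> 0"
  by (auto simp: besselK_imag_def set_lebesgue_integral_def intro!: Bochner_Integration.integral_nonneg)

text \<open>From \<open>\<bar>cos\<bar> \<le> 1\<close>. The bound is free of the spectral variable
  \<open>u\<close>, which later separates the variables in the dominating function for
  Fubini.\<close>

lemma abs_besselK_imag_le:
  assumes x: "x > 0"
  shows "\<bar>besselK_imag u x\<bar> \<le> besselK_imag 0 x"
proof -
  have [measurable]: "(cosh :: real \<Rightarrow> real) \<in> borel_measurable borel"
    by (intro borel_measurable_continuous_onI continuous_intros)
  have i: "integrable lborel (\<lambda>w. indicator {0<..} w *\<^sub>R exp (- x * cosh w))"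
    by (intro integrable_mult_indicator integrable_exp_cosh x) auto
  have j: "integrable lborel (\<lambda>w. indicator {0<..} w *\<^sub>R (exp (- x * cosh w) * cos (u * w)))"
    by (rule Bochner_Integration.integrable_bound[OF i]) (auto simp: abs_mult split: split_indicator)
  have "\<bar>besselK_imag u x\<bar> \<le>
      (\<integral>w. norm (indicator {0<..} w *\<^sub>R (exp (- x * cosh w) * cos (u * w))) \<partial>lborel)"
    unfolding besselK_imag_def set_lebesgue_integral_def real_norm_def[symmetric]
    by (rule integral_norm_bound)
  also have "\<dots> \<le> (\<integral>w. indicator {0<..} w *\<^sub>R exp (- x * cosh w) \<partial>lborel)"
    by (intro integral_mono integrable_norm i j) (auto simp: abs_mult split: split_indicator)
  finally show ?thesis by (simp add: besselK_imag_def set_lebesgue_integral_def)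
qed

section \<open>Rotated Gamma products and the two Mellin transforms\<close>

lemma exp_add_exp_diff: "exp (r + w) + exp (r - w) = 2 * exp r * cosh (w::real)"
  by (simp add: cosh_field_def exp_add exp_diff exp_minus field_simps)

lemma pair_sigma_finite_lborel:
  "pair_sigma_finite (lborel :: 'a::euclidean_space measure) (lborel :: 'b::euclidean_space measure)"
  ..

text \<open>With \<open>p = (\<alpha> + \<i> * u) / 2\<close>, the product of the integrals for
  \<open>Gamma p\<close> and \<open>Gamma (cnj p)\<close> is rewritten by \<open>x = r + w\<close>,
  \<open>y = r - w\<close>, whose Jacobian yields the \<open>1/2\<close>. This one double integral
  is used twice: integrating over \<open>w\<close> first gives the Mellin transform of the Bessel
  function, integrating over \<open>r\<close> first the Fourier transform of a power of
  \<open>cosh\<close>.\<close>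

lemma Gamma_rotation:
  fixes \<alpha> u :: real
  assumes \<alpha>: "\<alpha> > 0"
  shows "has_bochner_integral (lborel \<Otimes>\<^sub>M lborel)
    (\<lambda>(r, w). exp (\<i> * of_real (u * w) + of_real (\<alpha> * r - 2 * exp r * cosh w)))
    (of_real ((cmod (Gamma ((\<alpha> + \<i> * u) / 2)))\<^sup>2 / 2))"
proof -
  define p where "p = (\<alpha> + \<i> * u) / 2"
  have Re: "Re p > 0" "Re (cnj p) > 0" using \<alpha> by (auto simp: p_def)
  let ?g = "\<lambda>p x. exp (p * of_real x - of_real (exp x))"
  let ?F = "\<lambda>(x, y). ?g p x * ?g (cnj p) y"
  have "has_bochner_integral (lborel \<Otimes>\<^sub>M lborel) ?F (Gamma p * Gamma (cnj p))"
    by (intro has_bochner_integral_pair_mult pair_sigma_finite_lborel has_bochner_integral_Gamma_exp Re)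
  from has_bochner_integral_rotation[OF zero_less_one this]
  have "has_bochner_integral (lborel \<Otimes>\<^sub>M lborel) (\<lambda>(r, w). ?g p (r + w) * ?g (cnj p) (r - w))
      ((1 / 2) *\<^sub>R (Gamma p * Gamma (cnj p)))"
    by (simp add: case_prod_beta')
  moreover have "(1 / 2) *\<^sub>R (Gamma p * Gamma (cnj p)) = of_real ((cmod (Gamma p))\<^sup>2 / 2)"
    by (simp add: cnj_Gamma[symmetric] scaleR_conv_of_real flip: complex_norm_square)
  moreover have "?g p (r + w) * ?g (cnj p) (r - w) =
      exp (\<i> * of_real (u * w) + of_real (\<alpha> * r - 2 * exp r * cosh w))" for r w
  proof -
    have "?g p (r + w) * ?g (cnj p) (r - w) =
      exp ((p + cnj p) * of_real r + (p - cnj p) * of_real w - of_real (exp (r + w) + exp (r - w)))"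
      by (simp add: algebra_simps flip: exp_add)
    \<comment> \<open>Conjugate parameters make \<open>r\<close> carry only the real exponent
      \<open>\<alpha>\<close> and \<open>w\<close> only the frequency \<open>u\<close>.\<close>
    also have "p + cnj p = of_real \<alpha>" by (simp add: p_def complex_eq_iff)
    also have "p - cnj p = \<i> * of_real u" by (simp add: p_def complex_eq_iff)
    finally show ?thesis by (simp only: exp_add_exp_diff) (simp add: algebra_simps)
  qed
  ultimately show ?thesis unfolding p_def[symmetric] by (simp only:)
qed

text \<open>Integrating \<open>Gamma_rotation\<close> over \<open>w\<close> first produces the
  Bessel function at \<open>2 * exp r\<close>; a shift of \<open>r\<close> by \<open>ln 2\<close>
  brings it to \<open>exp r\<close>.\<close>

lemma has_bochner_integral_Mellin_besselK:
  fixes \<alpha> u :: real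
  assumes \<alpha>: "\<alpha> > 0"
  shows "has_bochner_integral lborel (\<lambda>r. exp (\<alpha> * r) * besselK_imag u (exp r))
    (2 powr (\<alpha> - 2) * (cmod (Gamma ((\<alpha> + \<i> * u) / 2)))\<^sup>2)"
proof -
  let ?G = "(cmod (Gamma ((\<alpha> + \<i> * u) / 2)))\<^sup>2"
  have inner: "has_bochner_integral lborel
      (\<lambda>w. exp (\<i> * of_real (u * w) + of_real (\<alpha> * r - 2 * exp r * cosh w)))
      (of_real (2 * exp (\<alpha> * r) * besselK_imag u (2 * exp r)))" for r
  proof -
    have "has_bochner_integral lborel
      (\<lambda>w. of_real (exp (\<alpha> * r)) * exp (\<i> * (u * w) - of_real (2 * exp r * cosh w)))
      (of_real (exp (\<alpha> * r)) * of_real (2 * besselK_imag u (2 * exp r)))"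
      by (intro has_bochner_integral_mult_right has_bochner_integral_besselK_imag) simp
    then show ?thesis
      by (simp add: algebra_simps exp_of_real[symmetric] flip: exp_add)
  qed
  have "has_bochner_integral lborel
      (\<lambda>r. complex_of_real (2 * exp (\<alpha> * r) * besselK_imag u (2 * exp r))) (of_real (?G / 2))"
    by (rule has_bochner_integral_fst[OF pair_sigma_finite_lborel Gamma_rotation[OF \<alpha>] inner])
  then have "has_bochner_integral lborel (\<lambda>r. 2 * exp (\<alpha> * r) * besselK_imag u (2 * exp r)) (?G / 2)"
    unfolding has_bochner_integral_complex_of_real .
  \<comment> \<open>After the shift, the factor \<open>2 powr \<alpha> / 2\<close> undoes
    \<open>exp (- \<alpha> * ln 2)\<close> and the doubling in the Bessel integral; with the
    \<open>1/2\<close> from the rotation it becomes \<open>2 powr (\<alpha> - 2)\<close>.\<close>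
  then have "has_bochner_integral lborel
      (\<lambda>r. 2 * exp (\<alpha> * (- ln 2 + 1 * r)) * besselK_imag u (2 * exp (- ln 2 + 1 * r))) (?G / 2)"
    by (subst (asm) lborel_has_bochner_integral_real_affine_iff[where c=1 and t="- ln 2"]) simp_all
  then have "has_bochner_integral lborel (\<lambda>r. (2 powr \<alpha> / 2) *
      (2 * exp (\<alpha> * (- ln 2 + 1 * r)) * besselK_imag u (2 * exp (- ln 2 + 1 * r)))) ((2 powr \<alpha> / 2) * (?G / 2))"
    by (intro has_bochner_integral_mult_right)
  moreover have "(2 powr \<alpha> / 2) * (2 * exp (\<alpha> * (- ln 2 + 1 * r)) * besselK_imag u (2 * exp (- ln 2 + 1 * r))) =
      exp (\<alpha> * r) * besselK_imag u (exp r)" for r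
    by (simp add: powr_def exp_add exp_diff exp_minus ring_distribs)
  moreover have "(2 powr \<alpha> / 2) * (?G / 2) = 2 powr (\<alpha> - 2) * ?G"
    by (simp add: powr_diff)
  ultimately show ?thesis by (simp only:)
qed

text \<open>The other order in \<open>Gamma_rotation\<close>: for fixed \<open>w\<close> the
  \<open>r\<close>-integral is a scaled Gamma integral with \<open>b = 2 * cosh w\<close>.\<close>

lemma has_bochner_integral_Fourier_cosh_powr:
  fixes \<alpha> u :: real
  assumes \<alpha>: "\<alpha> > 0"
  shows "has_bochner_integral lborel (\<lambda>w. exp (\<i> * of_real (u * w)) * of_real ((2 * cosh w) powr (- \<alpha>)))
    (of_real ((cmod (Gamma ((\<alpha> + \<i> * u) / 2)))\<^sup>2 / (2 * Gamma \<alpha>)))"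
proof -
  let ?G = "(cmod (Gamma ((\<alpha> + \<i> * u) / 2)))\<^sup>2"
  have inner: "has_bochner_integral lborel
      (\<lambda>r. exp (\<i> * of_real (u * w) + of_real (\<alpha> * r - 2 * exp r * cosh w)))
      (exp (\<i> * of_real (u * w)) * of_real (Gamma \<alpha> * (2 * cosh w) powr (- \<alpha>)))" for w
  proof -
    have "has_bochner_integral lborel
      (\<lambda>r. exp (\<i> * of_real (u * w)) * of_real (exp (\<alpha> * r - (2 * cosh w) * exp r)))
      (exp (\<i> * of_real (u * w)) * of_real (Gamma \<alpha> * (2 * cosh w) powr (- \<alpha>)))"
      by (intro has_bochner_integral_mult_right)
         (simp only: has_bochner_integral_complex_of_real, rule has_bochner_integral_Gamma_exp_scaled, use \<alpha> in auto)
    then show ?thesis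
      by (simp only: exp_of_real[symmetric] exp_add[symmetric]) (simp add: mult_ac)
  qed
  have "has_bochner_integral lborel
      (\<lambda>w. exp (\<i> * of_real (u * w)) * of_real (Gamma \<alpha> * (2 * cosh w) powr (- \<alpha>))) (of_real (?G / 2))"
    by (rule has_bochner_integral_snd[OF pair_sigma_finite_lborel Gamma_rotation[OF \<alpha>] inner])
  then have "has_bochner_integral lborel
      (\<lambda>w. of_real (1 / Gamma \<alpha>) * (exp (\<i> * of_real (u * w)) * of_real (Gamma \<alpha> * (2 * cosh w) powr (- \<alpha>))))
      (of_real (1 / Gamma \<alpha>) * of_real (?G / 2))"
    by (intro has_bochner_integral_mult_right)
  moreover have "of_real (1 / Gamma \<alpha>) * (exp (\<i> * of_real (u * w)) * of_real (Gamma \<alpha> * (2 * cosh w) powr (- \<alpha>))) =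
      exp (\<i> * of_real (u * w)) * complex_of_real ((2 * cosh w) powr (- \<alpha>))" for w
    using Gamma_real_pos[OF \<alpha>] by simp
  ultimately show ?thesis by (simp add: mult_ac)
qed

text \<open>Shows that the product of two \<open>cosh\<close> powers, in coordinates rotated with
  \<open>k = 1/2\<close>, depends only on \<open>cosh p + cosh q\<close>.\<close>

lemma cosh_mult_cosh_half:
  "4 * (cosh ((p + q) / 2) * cosh ((p - q) / 2)) = 2 * (cosh p + cosh (q::real))"
proof -
  have "cosh p = cosh ((p + q) / 2 + (p - q) / 2)" by (simp add: field_simps)
  moreover have "cosh q = cosh ((p + q) / 2 - (p - q) / 2)" by (simp add: field_simps)
  ultimately show ?thesis by (simp only: cosh_add cosh_diff) (simp add: algebra_simps)
qed

text \<open>Four times the product of Bessel functions is a double integral over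
  \<open>(p, q)\<close> with exponent
  \<open>\<i> * (u * p + v * q) - exp r * (cosh p + cosh q)\<close>. Integrating over
  \<open>r\<close> first leaves the Fourier transform of
  \<open>(cosh p + cosh q) powr (- \<alpha>)\<close>, which splits after rotation into two
  one-dimensional transforms at the frequencies \<open>u + v\<close> and
  \<open>u - v\<close>.\<close>

lemma has_bochner_integral_Mellin_besselK_mult:
  fixes \<alpha> u v :: real
  assumes \<alpha>: "\<alpha> > 0"
  shows "has_bochner_integral lborel
    (\<lambda>r. exp (\<alpha> * r) * (besselK_imag u (exp r) * besselK_imag v (exp r)))
    (2 powr (\<alpha> - 3) / Gamma \<alpha> *
      (cmod (Gamma ((\<alpha> + \<i> * (u + v)) / 2) * Gamma ((\<alpha> + \<i> * (u - v)) / 2)))\<^sup>2)"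
proof -
  let ?G = "\<lambda>u. (cmod (Gamma ((\<alpha> + \<i> * complex_of_real u) / 2)))\<^sup>2"
  let ?e = "\<lambda>u w. exp (\<i> * complex_of_real (u * w))"
  have [measurable]: "(cosh :: real \<Rightarrow> real) \<in> borel_measurable borel"
    by (intro borel_measurable_continuous_onI continuous_intros)
  have pos: "cosh p + cosh q > 0" for p q :: real
    by (intro add_pos_pos) auto
  \<comment> \<open>The rotation with \<open>k = 1/2\<close> contributes the factor 2, and
    \<open>2 powr \<alpha>\<close> removes the 2 in \<open>2 * (cosh p + cosh q)\<close>. The
    frequencies are generalized because the case of zero frequencies supplies integrability
    below.\<close>
  have rot: "has_bochner_integral (lborel \<Otimes>\<^sub>M lborel)
      (\<lambda>(p, q). ?e u p * ?e v q * of_real ((cosh p + cosh q) powr (- \<alpha>)))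
      (of_real (2 powr \<alpha> * ?G (u + v) * ?G (u - v) / (2 * (Gamma \<alpha>)\<^sup>2)))" for u v
  proof -
    let ?h = "\<lambda>u w. ?e u w * of_real ((2 * cosh w) powr (- \<alpha>))"
    let ?I = "(complex_of_real (?G (u + v) / (2 * Gamma \<alpha>)) * of_real (?G (u - v) / (2 * Gamma \<alpha>)))"
    have "has_bochner_integral (lborel \<Otimes>\<^sub>M lborel) (\<lambda>(A, B). ?h (u + v) A * ?h (u - v) B) ?I"
      by (intro has_bochner_integral_pair_mult pair_sigma_finite_lborel has_bochner_integral_Fourier_cosh_powr \<alpha>)
    from has_bochner_integral_rotation[OF _ this, of "1 / 2"]
    have "has_bochner_integral (lborel \<Otimes>\<^sub>M lborel)
       (\<lambda>(p, q). ?h (u + v) ((p + q) / 2) * ?h (u - v) ((p - q) / 2)) (2 *\<^sub>R ?I)"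
      by (simp add: case_prod_beta' power2_eq_square)
    then have "has_bochner_integral (lborel \<Otimes>\<^sub>M lborel)
       (\<lambda>z. of_real (2 powr \<alpha>) * (case z of (p, q) \<Rightarrow> ?h (u + v) ((p + q) / 2) * ?h (u - v) ((p - q) / 2)))
       (of_real (2 powr \<alpha>) * (2 *\<^sub>R ?I))"
      by (intro has_bochner_integral_mult_right)
    moreover have "of_real (2 powr \<alpha>) * (?h (u + v) ((p + q) / 2) * ?h (u - v) ((p - q) / 2)) =
        ?e u p * ?e v q * of_real ((cosh p + cosh q) powr (- \<alpha>))" for p q
    proof -
      have "(u + v) * ((p + q) / 2) + (u - v) * ((p - q) / 2) = u * p + v * q"
        by (simp add: field_simps)
      then have e: "?e (u + v) ((p + q) / 2) * ?e (u - v) ((p - q) / 2) = ?e u p * ?e v q"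
        by (simp only: exp_add[symmetric] distrib_left[symmetric] of_real_add[symmetric])
      have "(2 * cosh ((p + q) / 2)) powr (- \<alpha>) * (2 * cosh ((p - q) / 2)) powr (- \<alpha>) =
          (4 * (cosh ((p + q) / 2) * cosh ((p - q) / 2))) powr (- \<alpha>)"
        by (simp add: mult_ac flip: powr_mult)
      also have "\<dots> = 2 powr (- \<alpha>) * (cosh p + cosh q) powr (- \<alpha>)"
        unfolding cosh_mult_cosh_half by (rule powr_mult)
      finally have c: "2 powr \<alpha> * ((2 * cosh ((p + q) / 2)) powr (- \<alpha>) * (2 * cosh ((p - q) / 2)) powr (- \<alpha>)) =
          (cosh p + cosh q) powr (- \<alpha>)"
        by (simp add: powr_minus)
      show ?thesis
        unfolding c[symmetric] e[symmetric] by (simp only: of_real_mult mult_ac)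
    qed
    moreover have "of_real (2 powr \<alpha>) * (2 *\<^sub>R ?I) =
        of_real (2 powr \<alpha> * ?G (u + v) * ?G (u - v) / (2 * (Gamma \<alpha>)\<^sup>2))"
      by (simp add: scaleR_conv_of_real power2_eq_square)
    ultimately show ?thesis by (simp add: case_prod_beta')
  qed
  let ?k = "\<lambda>z r. ?e u (fst z) * ?e v (snd z) * of_real (exp (\<alpha> * r - (cosh (fst z) + cosh (snd z)) * exp r))"
  have psf: "pair_sigma_finite (lborel \<Otimes>\<^sub>M lborel :: (real \<times> real) measure) (lborel :: real measure)"
    unfolding lborel_prod by (rule pair_sigma_finite_lborel)
  interpret P: pair_sigma_finite "lborel \<Otimes>\<^sub>M lborel :: (real \<times> real) measure" "lborel :: real measure"
    by (rule psf)
  have inner1: "has_bochner_integral lborel (\<lambda>r. exp (\<alpha> * r - (cosh p + cosh q) * exp r))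
      (Gamma \<alpha> * (cosh p + cosh q) powr (- \<alpha>))" for p q
    by (rule has_bochner_integral_Gamma_exp_scaled[OF \<alpha> pos])
  have kint: "integrable ((lborel \<Otimes>\<^sub>M lborel) \<Otimes>\<^sub>M lborel) (\<lambda>(z, r). ?k z r)"
  proof (rule P.Fubini_integrable)
    show "(\<lambda>(z, r). ?k z r) \<in> borel_measurable ((lborel \<Otimes>\<^sub>M lborel) \<Otimes>\<^sub>M lborel)"
      by measurable
    have "(\<integral>r. norm (?k (p, q) r) \<partial>lborel) = Gamma \<alpha> * (cosh p + cosh q) powr (- \<alpha>)" for p q
      using inner1[of p q] by (simp add: norm_mult has_bochner_integral_iff)
    \<comment> \<open>At zero frequencies the oscillating factors are 1, so \<open>rot\<close>
      asserts exactly the absolute integrability that Fubini asks for.\<close>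
    moreover have "integrable (lborel \<Otimes>\<^sub>M lborel) (\<lambda>(p, q). Gamma \<alpha> * (cosh p + cosh q) powr (- \<alpha>))"
      using rot[of 0 0] by (auto simp: case_prod_beta' has_bochner_integral_complex_of_real dest: has_bochner_integral_integrable
        simp: has_bochner_integral_iff complex_of_real_integrable_eq)
    ultimately show "integrable (lborel \<Otimes>\<^sub>M lborel) (\<lambda>x. \<integral>y. norm (case (x, y) of (z, r) \<Rightarrow> ?k z r) \<partial>lborel)"
      by (simp add: case_prod_beta')
    have "integrable lborel (?k (p, q))" for p q
      using inner1[of p q] by (auto simp: has_bochner_integral_iff complex_of_real_integrable_eq)
    then show "AE x in lborel \<Otimes>\<^sub>M lborel. integrable lborel (\<lambda>y. case (x, y) of (z, r) \<Rightarrow> ?k z r)"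
      by (auto simp: case_prod_beta')
  qed
  \<comment> \<open>The triple integral \<open>?J\<close> is left unevaluated here; integrating over
    \<open>r\<close> first computes it, and integrating over \<open>(p, q)\<close> first identifies
    it with the Mellin integral.\<close>
  then have hk: "has_bochner_integral ((lborel \<Otimes>\<^sub>M lborel) \<Otimes>\<^sub>M lborel) (\<lambda>(z, r). ?k z r)
      (\<integral>(z, r). ?k z r \<partial>((lborel \<Otimes>\<^sub>M lborel) \<Otimes>\<^sub>M lborel))" (is "has_bochner_integral _ _ ?J")
    by (rule has_bochner_integral_integrable)
  have "has_bochner_integral lborel (?k z)
     (of_real (Gamma \<alpha>) * (case z of (p, q) \<Rightarrow> ?e u p * ?e v q * of_real ((cosh p + cosh q) powr (- \<alpha>))))" for z
  proof -
    obtain p q where z: "z = (p, q)" by force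
    have "has_bochner_integral lborel (?k (p, q))
       (?e u p * ?e v q * of_real (Gamma \<alpha> * (cosh p + cosh q) powr (- \<alpha>)))"
      unfolding fst_conv snd_conv
      by (intro has_bochner_integral_mult_right) (simp only: has_bochner_integral_complex_of_real inner1)
    then show ?thesis by (simp add: z mult_ac)
  qed
  from has_bochner_integral_fst[OF psf hk this]
  have "has_bochner_integral (lborel \<Otimes>\<^sub>M lborel) (\<lambda>z. of_real (Gamma \<alpha>) *
     (case z of (p, q) \<Rightarrow> ?e u p * ?e v q * of_real ((cosh p + cosh q) powr (- \<alpha>)))) ?J" .
  moreover have "has_bochner_integral (lborel \<Otimes>\<^sub>M lborel) (\<lambda>z. of_real (Gamma \<alpha>) *
     (case z of (p, q) \<Rightarrow> ?e u p * ?e v q * of_real ((cosh p + cosh q) powr (- \<alpha>))))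
     (of_real (Gamma \<alpha>) * of_real (2 powr \<alpha> * ?G (u + v) * ?G (u - v) / (2 * (Gamma \<alpha>)\<^sup>2)))"
    by (intro has_bochner_integral_mult_right rot)
  ultimately have "?J = of_real (Gamma \<alpha>) * of_real (2 powr \<alpha> * ?G (u + v) * ?G (u - v) / (2 * (Gamma \<alpha>)\<^sup>2))"
    by (rule has_bochner_integral_eq)
  also have "\<dots> = of_real (2 powr \<alpha> * ?G (u + v) * ?G (u - v) / (2 * Gamma \<alpha>))"
    using Gamma_real_pos[OF \<alpha>] by (simp add: power2_eq_square)
  finally have J: "?J = \<dots>" .
  have "has_bochner_integral (lborel \<Otimes>\<^sub>M lborel) (\<lambda>z. ?k z r)
     (of_real (4 * (exp (\<alpha> * r) * (besselK_imag u (exp r) * besselK_imag v (exp r)))))" for r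
  proof -
    have "has_bochner_integral (lborel \<Otimes>\<^sub>M lborel)
      (\<lambda>(p, q). exp (\<i> * (u * p) - of_real (exp r * cosh p)) * exp (\<i> * (v * q) - of_real (exp r * cosh q)))
      (of_real (2 * besselK_imag u (exp r)) * of_real (2 * besselK_imag v (exp r)))"
      by (intro has_bochner_integral_pair_mult pair_sigma_finite_lborel has_bochner_integral_besselK_imag) auto
    then have "has_bochner_integral (lborel \<Otimes>\<^sub>M lborel) (\<lambda>z. of_real (exp (\<alpha> * r)) *
      (case z of (p, q) \<Rightarrow> exp (\<i> * (u * p) - of_real (exp r * cosh p)) * exp (\<i> * (v * q) - of_real (exp r * cosh q))))
      (of_real (exp (\<alpha> * r)) * (of_real (2 * besselK_imag u (exp r)) * of_real (2 * besselK_imag v (exp r))))"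
      by (intro has_bochner_integral_mult_right)
    moreover have "of_real (exp (\<alpha> * r)) *
      (case z of (p, q) \<Rightarrow> exp (\<i> * (u * p) - of_real (exp r * cosh p)) * exp (\<i> * (v * q) - of_real (exp r * cosh q))) = ?k z r" for z
      by (cases z) (simp add: algebra_simps exp_of_real[symmetric] flip: exp_add)
    ultimately show ?thesis by (simp add: mult_ac)
  qed
  from has_bochner_integral_snd[OF psf hk this]
  have "has_bochner_integral lborel (\<lambda>r. 4 * (exp (\<alpha> * r) * (besselK_imag u (exp r) * besselK_imag v (exp r))))
     (2 powr \<alpha> * ?G (u + v) * ?G (u - v) / (2 * Gamma \<alpha>))"
    unfolding J has_bochner_integral_complex_of_real .
  then have "has_bochner_integral lborel (\<lambda>r. (1 / 4) * (4 * (exp (\<alpha> * r) * (besselK_imag u (exp r) * besselK_imag v (exp r)))))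
     ((1 / 4) * (2 powr \<alpha> * ?G (u + v) * ?G (u - v) / (2 * Gamma \<alpha>)))"
    by (intro has_bochner_integral_mult_right)
  then show ?thesis
    by (simp add: powr_diff norm_mult power_mult_distrib mult_ac)
qed

section \<open>Spectral form of chains of heat kernels\<close>

text \<open>At \<open>z = \<i> * v\<close> the reflection formula for
  \<open>Gamma z * Gamma (- z)\<close> gives the squared modulus as
  \<open>pi / (v * sinh (pi * v))\<close>, and
  \<open>sinh (pi * v) \<le> exp (pi * v)\<close>.\<close>

lemma inverse_Gamma_imag_le:
  assumes v: "v > 0"
  shows "1 / (cmod (Gamma (\<i> * v)))\<^sup>2 \<le> v * exp (pi * v) / pi"
proof -
  let ?z = "\<i> * complex_of_real v"
  have "Gamma (- ?z) = cnj (Gamma ?z)" by (simp add: cnj_Gamma)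
  then have "of_real ((cmod (Gamma ?z))\<^sup>2) = - of_real pi / (?z * sin (of_real pi * ?z))"
    using Gamma_reflection_complex'[of ?z] by (simp flip: complex_norm_square)
  then have "cmod (of_real ((cmod (Gamma ?z))\<^sup>2)) = cmod (- of_real pi / (?z * sin (of_real pi * ?z)))"
    by simp
  then have G: "(cmod (Gamma ?z))\<^sup>2 = pi / (v * cmod (sin (of_real pi * ?z)))"
    using v by (simp add: norm_divide norm_mult norm_power)
  have "cmod (sin (of_real pi * ?z)) = cmod (exp (\<i> * (of_real pi * ?z)) - exp (- (\<i> * (of_real pi * ?z)))) / 2"
    by (simp add: sin_exp_eq norm_divide norm_mult)
  also have "\<dots> \<le> (cmod (exp (\<i> * (of_real pi * ?z))) + cmod (exp (- (\<i> * (of_real pi * ?z))))) / 2"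
    by (intro divide_right_mono norm_triangle_ineq4) auto
  also have "\<dots> = (exp (- (pi * v)) + exp (pi * v)) / 2" by simp
  also have "\<dots> \<le> exp (pi * v)" using v by simp
  finally have "cmod (sin (of_real pi * ?z)) \<le> exp (pi * v)" .
  then show ?thesis unfolding G using v by (simp add: divide_right_mono)
qed

text \<open>\<open>Gamma\<close> is discontinuous at its poles, but it is the inverse of the entire
  function \<open>rGamma\<close>.\<close>

lemma Gamma_measurable [measurable]: "(Gamma :: complex \<Rightarrow> complex) \<in> borel_measurable borel"
proof -
  have [measurable]: "(rGamma :: complex \<Rightarrow> complex) \<in> borel_measurable borel"
    by (intro borel_measurable_continuous_onI continuous_intros)
  show ?thesis unfolding Gamma_def[abs_def] by measurable
qed

text \<open>Density of the image of the spectral measure under \<open>u \<mapsto> u\<^sup>2\<close>.\<close>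
definition spectral_density :: "real \<Rightarrow> real" where
  "spectral_density z = indicator {0<..} z / (pi * sqrt z * (cmod (Gamma (\<i> * sqrt z)))\<^sup>2)"

lemma spectral_density_measurable [measurable]: "spectral_density \<in> borel_measurable borel"
  unfolding spectral_density_def[abs_def] by measurable

lemma spectral_density_nonneg: "spectral_density z \<ge> 0"
  by (auto simp: spectral_density_def split: split_indicator)

text \<open>The spectral density grows at most like \<open>exp (pi * sqrt z)\<close>; half of the
  decay \<open>exp (- (t * z))\<close> absorbs this growth and the other half remains for
  integrability.\<close>

lemma integrable_exp_spectral_density:
  fixes t :: real
  assumes t: "t > 0"
  shows "integrable lborel (\<lambda>z. exp (- (t * z)) * spectral_density z)"
proof (rule Bochner_Integration.integrable_bound)
  let ?b = "\<lambda>z. exp (pi\<^sup>2 / (2 * t)) / pi\<^sup>2 * (indicator {0<..} z *\<^sub>R exp (- (z * (t / 2))))"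
  show "integrable lborel ?b"
    using integrable_I0i_exp_mscale[of "t / 2"] t
    by (intro integrable_mult_right) (simp add: set_integrable_def)
  show "AE z in lborel. norm (exp (- (t * z)) * spectral_density z) \<le> norm (?b z)"
  proof (intro AE_I2)
    fix z :: real
    show "norm (exp (- (t * z)) * spectral_density z) \<le> norm (?b z)"
    proof (cases "z > 0")
      case True
      define s where "s = sqrt z"
      have s: "s > 0" "z = s\<^sup>2" using True by (auto simp: s_def)
      have "spectral_density z = (1 / (cmod (Gamma (\<i> * s)))\<^sup>2) / (pi * s)"
        using True by (simp add: spectral_density_def s_def)
      also have "\<dots> \<le> (s * exp (pi * s) / pi) / (pi * s)"
        using s by (intro divide_right_mono inverse_Gamma_imag_le) auto
      also have "\<dots> = exp (pi * s) / pi\<^sup>2" using s by (simp add: power2_eq_square)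
      finally have 1: "spectral_density z \<le> exp (pi * s) / pi\<^sup>2" .
      \<comment> \<open>Completing the square.\<close>
      have "pi * s - t * z \<le> pi\<^sup>2 / (2 * t) - z * (t / 2)"
      proof -
        have "0 \<le> (t * s - pi)\<^sup>2 / (2 * t)" using t by simp
        also have "\<dots> = (pi\<^sup>2 / (2 * t) - z * (t / 2)) - (pi * s - t * z)"
          using t by (simp add: s field_simps power2_eq_square)
        finally show ?thesis by (simp add: algebra_simps)
      qed
      then have "exp (pi * s - t * z) \<le> exp (pi\<^sup>2 / (2 * t) - z * (t / 2))" by simp
      then have "exp (pi * s - t * z) / pi\<^sup>2 \<le> exp (pi\<^sup>2 / (2 * t) - z * (t / 2)) / pi\<^sup>2"
        by (intro divide_right_mono) auto
      moreover have "exp (pi * s - t * z) = exp (- (t * z)) * exp (pi * s)"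
        by (simp flip: exp_add)
      moreover have "exp (pi\<^sup>2 / (2 * t) - z * (t / 2)) = exp (pi\<^sup>2 / (2 * t)) * exp (- (z * (t / 2)))"
        by (simp flip: exp_add)
      ultimately have 2: "exp (- (t * z)) * (exp (pi * s) / pi\<^sup>2) \<le> ?b z"
        using True by simp
      have "exp (- (t * z)) * spectral_density z \<le> exp (- (t * z)) * (exp (pi * s) / pi\<^sup>2)"
        using 1 by (intro mult_left_mono) auto
      with 2 have "exp (- (t * z)) * spectral_density z \<le> ?b z" by linarith
      moreover have "0 \<le> exp (- (t * z)) * spectral_density z"
        by (simp add: spectral_density_nonneg)
      ultimately show ?thesis by (simp only: real_norm_def abs_of_nonneg)
    qed (simp add: spectral_density_def)
  qed
qed simp

text \<open>Substitution \<open>z = u\<^sup>2\<close>: the Jacobian \<open>2 * u\<close> turns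
  \<open>spectral_density\<close> back into the density of \<open>spectral_measure\<close>. The new
  variable lives on the scale of the states of the dual process. Absolute convergence comes from the
  bound at index 0.\<close>

lemma has_bochner_integral_p_heat:
  assumes t: "t > 0"
  shows "has_bochner_integral lborel (\<lambda>z. exp (- (t * z)) * spectral_density z *
      (besselK_imag (sqrt z) (exp x) * besselK_imag (sqrt z) (exp y))) (p_heat t x y)"
proof -
  let ?\<kappa> = "\<lambda>z x. besselK_imag (sqrt z) (exp x)"
  let ?h = "\<lambda>z. exp (- (t * z)) * spectral_density z * (?\<kappa> z x * ?\<kappa> z y)"
  have "integrable lborel ?h"
  proof (rule Bochner_Integration.integrable_bound)
    show "integrable lborel (\<lambda>z. exp (- (t * z)) * spectral_density z * (?\<kappa> 0 x * ?\<kappa> 0 y))"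
      by (intro integrable_mult_left integrable_exp_spectral_density t)
    show "AE z in lborel. norm (?h z) \<le> norm (exp (- (t * z)) * spectral_density z * (?\<kappa> 0 x * ?\<kappa> 0 y))"
      by (auto simp: abs_mult spectral_density_nonneg besselK_imag_0_nonneg
          intro!: mult_left_mono mult_mono abs_besselK_imag_le)
  qed simp
  then have h: "has_bochner_integral lborel ?h (\<integral>z. ?h z \<partial>lborel)"
    by (rule has_bochner_integral_integrable)
  have img: "(\<lambda>u::real. u\<^sup>2) ` {0<..} = {0<..}"
  proof safe
    fix z :: real assume "z > 0"
    then show "z \<in> (\<lambda>u. u\<^sup>2) ` {0<..}" by (intro image_eqI[of _ _ "sqrt z"]) auto
  qed auto
  \<comment> \<open>\<open>spectral_density\<close> vanishes off \<open>{0<..}\<close>, so the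
    integral over the half-line is the one over \<open>lborel\<close>.\<close>
  have "indicator {0<..} z *\<^sub>R ?h z = ?h z" for z
    by (simp add: spectral_density_def split: split_indicator)
  then have "?h absolutely_integrable_on {0<..} \<and> integral {0<..} ?h = (\<integral>z. ?h z \<partial>lborel)"
    using h by (subst absolutely_integrable_on_lborel) (simp_all only: set_borel_measurable_def, simp)
  then have "(\<lambda>u. \<bar>2 * u\<bar> *\<^sub>R ?h (u\<^sup>2)) absolutely_integrable_on {0<..} \<and>
      integral {0<..} (\<lambda>u. \<bar>2 * u\<bar> *\<^sub>R ?h (u\<^sup>2)) = (\<integral>z. ?h z \<partial>lborel)"
    by (subst has_absolute_integral_change_of_variables_real)
       (auto simp: img inj_on_def power2_eq_iff_nonneg intro!: derivative_eq_intros)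
  then have "has_bochner_integral lborel (\<lambda>u. indicator {0<..} u *\<^sub>R (\<bar>2 * u\<bar> *\<^sub>R ?h (u\<^sup>2))) (\<integral>z. ?h z \<partial>lborel)"
    by (subst (asm) absolutely_integrable_on_lborel) (auto simp: set_borel_measurable_def)
  moreover have "indicator {0<..} u *\<^sub>R (\<bar>2 * u\<bar> *\<^sub>R ?h (u\<^sup>2)) =
      (indicator {0<..} u * (2 / pi) / (cmod (Gamma (\<i> * u)))\<^sup>2) *\<^sub>R
      (exp (- t * u\<^sup>2) * besselK_imag u (exp x) * besselK_imag u (exp y))" for u
    by (simp add: spectral_density_def split: split_indicator)
  ultimately have "has_bochner_integral lborel (\<lambda>u. (indicator {0<..} u * (2 / pi) / (cmod (Gamma (\<i> * u)))\<^sup>2) *\<^sub>R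
      (exp (- t * u\<^sup>2) * besselK_imag u (exp x) * besselK_imag u (exp y))) (\<integral>z. ?h z \<partial>lborel)"
    by simp
  then have "has_bochner_integral spectral_measure (\<lambda>u. exp (- t * u\<^sup>2) * besselK_imag u (exp x) * besselK_imag u (exp y))
      (\<integral>z. ?h z \<partial>lborel)"
    unfolding spectral_measure_def by (intro has_bochner_integral_density) (auto split: split_indicator)
  then have "p_heat t x y = (\<integral>z. ?h z \<partial>lborel)"
    unfolding p_heat_def by (rule has_bochner_integral_integral_eq)
  with h show ?thesis by simp
qed

text \<open>Closed form of the Mellin transform of a single Bessel function, taken in the variable
  \<open>exp r\<close>.\<close>

definition Mellin_K :: "real \<Rightarrow> real \<Rightarrow> real" where
  "Mellin_K \<alpha> u = 2 powr (\<alpha> - 2) * (cmod (Gamma ((\<alpha> + \<i> * u) / 2)))\<^sup>2"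

text \<open>Closed form of the Mellin transform of a product of two Bessel functions with indices
  \<open>u\<close> and \<open>v\<close>.\<close>

definition Mellin_KK :: "real \<Rightarrow> real \<Rightarrow> real \<Rightarrow> real" where
  "Mellin_KK \<alpha> u v = 2 powr (\<alpha> - 3) / Gamma \<alpha> *
    (cmod (Gamma ((\<alpha> + \<i> * (u + v)) / 2) * Gamma ((\<alpha> + \<i> * (u - v)) / 2)))\<^sup>2"

text \<open>
  In the chain of kernels the point \<open>x\<^sub>k\<close> is shared by the kernels with spectral variables \<open>z k\<close>
  and \<open>z (k + 1)\<close>; each of the end points \<open>k = 0\<close> and \<open>k = n\<close> belongs to one kernel only.
\<close>
definition vertex_weight :: "nat \<Rightarrow> (nat \<Rightarrow> real) \<Rightarrow> nat \<Rightarrow> real \<Rightarrow> (nat \<Rightarrow> real) \<Rightarrow> real" where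
  "vertex_weight n \<alpha> k r z = exp (\<alpha> k * r) *
    ((if k = n then 1 else besselK_imag (sqrt (z (k + 1))) (exp r)) *
     (if k = 0 then 1 else besselK_imag (sqrt (z k)) (exp r)))"

text \<open>What remains of \<open>vertex_weight\<close> once \<open>r\<close> is integrated out.
  The order \<open>z (k + 1)\<close>, \<open>z k\<close> follows the evolution of the dual process,
  which runs towards smaller indices.\<close>

definition vertex_integral :: "nat \<Rightarrow> (nat \<Rightarrow> real) \<Rightarrow> nat \<Rightarrow> (nat \<Rightarrow> real) \<Rightarrow> real" where
  "vertex_integral n \<alpha> k z =
    (if k = 0 then Mellin_K (\<alpha> 0) (sqrt (z 1))
     else if k = n then Mellin_K (\<alpha> n) (sqrt (z n))
     else Mellin_KK (\<alpha> k) (sqrt (z (k + 1))) (sqrt (z k)))"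

section \<open>Vertex and edge factorizations of the chain\<close>

lemma has_bochner_integral_vertex_weight:
  assumes "n \<ge> 1" "\<alpha> k > 0"
  shows "has_bochner_integral lborel (\<lambda>r. vertex_weight n \<alpha> k r z) (vertex_integral n \<alpha> k z)"
  using has_bochner_integral_Mellin_besselK[OF assms(2)]
    has_bochner_integral_Mellin_besselK_mult[OF assms(2)] assms(1)
  by (auto simp: vertex_weight_def vertex_integral_def Mellin_K_def Mellin_KK_def)

text \<open>The constant \<open>\<lambda>_. 0\<close> puts the dominating index-0 Bessel function in
  every slot, because \<open>sqrt 0 = 0\<close>; the bound no longer depends on
  \<open>z\<close>.\<close>

lemma abs_vertex_weight_le:
  "\<bar>vertex_weight n \<alpha> k r z\<bar> \<le> vertex_weight n \<alpha> k r (\<lambda>_. 0)"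
  by (auto simp: vertex_weight_def abs_mult besselK_imag_0_nonneg
      intro!: mult_left_mono mult_mono abs_besselK_imag_le)

text \<open>Each Bessel factor belongs to a vertex and an adjacent edge of the chain; the product
  over vertices is regrouped by edges.\<close>

lemma prod_vertex_weight:
  "(\<Prod>k\<in>{0..n}. vertex_weight n \<alpha> k (x k) z) =
    (\<Prod>k\<in>{0..n}. exp (\<alpha> k * x k)) *
    (\<Prod>k\<in>{1..n}. besselK_imag (sqrt (z k)) (exp (x (k - 1))) * besselK_imag (sqrt (z k)) (exp (x k)))"
proof -
  let ?\<kappa> = "\<lambda>k r. besselK_imag (sqrt (z k)) (exp r)"
  \<comment> \<open>Vertex \<open>k\<close> with its right edge \<open>k + 1\<close> is edge
    \<open>k\<close> with its left vertex \<open>k - 1\<close>, shifted by one; the last vertex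
    contributes 1.\<close>
  have 1: "(\<Prod>k\<in>{0..n}. if k = n then 1 else ?\<kappa> (k + 1) (x k)) = (\<Prod>k\<in>{1..n}. ?\<kappa> k (x (k - 1)))"
  proof -
    have "(\<Prod>k\<in>{1..n}. ?\<kappa> k (x (k - 1))) = (\<Prod>k<n. ?\<kappa> (Suc k) (x k))"
      by (simp add: prod.atLeast1_atMost_eq)
    also have "\<dots> = (\<Prod>k\<in>{0..n}. if k = n then 1 else ?\<kappa> (k + 1) (x k))"
      by (rule prod.mono_neutral_cong_left) auto
    finally show ?thesis ..
  qed
  have 2: "(\<Prod>k\<in>{0..n}. if k = 0 then 1 else ?\<kappa> k (x k)) = (\<Prod>k\<in>{1..n}. ?\<kappa> k (x k))"
    by (rule prod.mono_neutral_cong_right) auto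
  show ?thesis
    unfolding vertex_weight_def prod.distrib 1 2 ..
qed

lemma (in product_sigma_finite) has_bochner_integral_prod:
  fixes f :: "'i \<Rightarrow> 'a \<Rightarrow> 'b::{real_normed_field, banach, second_countable_topology}"
  assumes "finite I" "\<And>i. i \<in> I \<Longrightarrow> has_bochner_integral (M i) (f i) (v i)"
  shows "has_bochner_integral (PiM I M) (\<lambda>x. \<Prod>i\<in>I. f i (x i)) (\<Prod>i\<in>I. v i)"
proof -
  have "integrable (M i) (f i)" "integral\<^sup>L (M i) (f i) = v i" if "i \<in> I" for i
    using assms(2)[OF that] by (auto simp: has_bochner_integral_iff)
  then show ?thesis
    using assms(1) unfolding has_bochner_integral_iff
    by (simp add: product_integrable_prod product_integral_prod)
qed

text \<open>The joint integrand in \<open>(x, z)\<close> is, for fixed \<open>z\<close>, a product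
  over vertices and, for fixed \<open>x\<close>, a product over edges. Either partial integration
  thus reduces to one-dimensional integrals, and \<open>v\<close> is the common joint
  integral.\<close>

lemma heat_chain_duality:
  fixes \<alpha> e :: "nat \<Rightarrow> real"
  assumes n: "n \<ge> 1" and \<alpha>: "\<And>k. k \<le> n \<Longrightarrow> \<alpha> k > 0" and e: "\<And>k. k \<in> {1..n} \<Longrightarrow> e k > 0"
  obtains v where
    "has_bochner_integral (PiM {0..n} (\<lambda>_. lborel))
      (\<lambda>x. (\<Prod>k\<in>{0..n}. exp (\<alpha> k * x k)) * (\<Prod>k\<in>{1..n}. p_heat (e k) (x (k - 1)) (x k))) v"
    "has_bochner_integral (PiM {1..n} (\<lambda>_. lborel))
      (\<lambda>z. (\<Prod>k\<in>{0..n}. vertex_integral n \<alpha> k z) * (\<Prod>k\<in>{1..n}. exp (- (e k * z k)) * spectral_density (z k))) v"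
proof -
  let ?X = "PiM {0..n} (\<lambda>_. lborel :: real measure)" and ?Z = "PiM {1..n} (\<lambda>_. lborel :: real measure)"
  interpret product_sigma_finite "\<lambda>_::nat. lborel :: real measure" ..
  have sX: "sigma_finite_measure ?X" and sZ: "sigma_finite_measure ?Z"
    by (auto intro!: sigma_finite)
  have psf: "pair_sigma_finite ?X ?Z"
    by (intro pair_sigma_finite.intro sX sZ)
  let ?w = "\<lambda>k \<zeta>. exp (- (e k * \<zeta>)) * spectral_density \<zeta>"
  let ?W = "\<lambda>z. \<Prod>k\<in>{1..n}. ?w k (z k)"
  let ?A = "\<lambda>x z. \<Prod>k\<in>{0..n}. vertex_weight n \<alpha> k (x k) z"
  have W: "integrable ?Z ?W"
    by (intro product_integrable_prod integrable_exp_spectral_density e) auto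
  have A: "has_bochner_integral ?X (\<lambda>x. ?A x z) (\<Prod>k\<in>{0..n}. vertex_integral n \<alpha> k z)" for z
    by (intro has_bochner_integral_prod has_bochner_integral_vertex_weight n \<alpha>) auto
  \<comment> \<open>Evaluating the vertex weights at zero spectral variables yields a dominating
    function of the form (function of \<open>x\<close>) times (function of \<open>z\<close>), each
    factor integrable.\<close>
  have int: "integrable (?X \<Otimes>\<^sub>M ?Z) (\<lambda>(x, z). ?A x z * ?W z)"
  proof (rule Bochner_Integration.integrable_bound)
    show "integrable (?X \<Otimes>\<^sub>M ?Z) (\<lambda>(x, z). ?A x (\<lambda>_. 0) * ?W z)"
      using has_bochner_integral_pair_mult[OF psf A[of "\<lambda>_. 0"] has_bochner_integral_integrable[OF W]]
      by (simp add: has_bochner_integral_iff)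
    show "(\<lambda>(x, z). ?A x z * ?W z) \<in> borel_measurable (?X \<Otimes>\<^sub>M ?Z)"
    proof -
      have "(\<lambda>(x, z). vertex_weight n \<alpha> k (x k) z) \<in> borel_measurable (?X \<Otimes>\<^sub>M ?Z)" if "k \<in> {0..n}" for k
        unfolding vertex_weight_def using that by (cases "k = 0"; cases "k = n") auto
      then show ?thesis
        unfolding case_prod_beta' by (intro borel_measurable_times borel_measurable_prod) auto
    qed
    show "AE p in ?X \<Otimes>\<^sub>M ?Z. norm (case p of (x, z) \<Rightarrow> ?A x z * ?W z) \<le>
        norm (case p of (x, z) \<Rightarrow> ?A x (\<lambda>_. 0) * ?W z)"
    proof (intro AE_I2, clarify)
      fix x z :: "nat \<Rightarrow> real"
      have "\<bar>?A x z\<bar> \<le> ?A x (\<lambda>_. 0)"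
        unfolding abs_prod by (intro prod_mono) (auto intro: abs_vertex_weight_le)
      then show "norm (?A x z * ?W z) \<le> norm (?A x (\<lambda>_. 0) * ?W z)"
        by (auto simp: abs_mult intro!: mult_right_mono)
    qed
  qed
  then have hb: "has_bochner_integral (?X \<Otimes>\<^sub>M ?Z) (\<lambda>(x, z). ?A x z * ?W z)
      (\<integral>(x, z). ?A x z * ?W z \<partial>(?X \<Otimes>\<^sub>M ?Z))" (is "has_bochner_integral _ _ ?v")
    by (rule has_bochner_integral_integrable)
  show thesis
  proof
    have "has_bochner_integral ?Z (\<lambda>z. ?A x z * ?W z)
      ((\<Prod>k\<in>{0..n}. exp (\<alpha> k * x k)) * (\<Prod>k\<in>{1..n}. p_heat (e k) (x (k - 1)) (x k)))" for x
    proof -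
      let ?f = "\<lambda>k \<zeta>. ?w k \<zeta> * (besselK_imag (sqrt \<zeta>) (exp (x (k - 1))) * besselK_imag (sqrt \<zeta>) (exp (x k)))"
      have "has_bochner_integral lborel (?f k) (p_heat (e k) (x (k - 1)) (x k))" if "k \<in> {1..n}" for k
        by (rule has_bochner_integral_p_heat[OF e[OF that]])
      then have "has_bochner_integral ?Z (\<lambda>z. \<Prod>k\<in>{1..n}. ?f k (z k)) (\<Prod>k\<in>{1..n}. p_heat (e k) (x (k - 1)) (x k))"
        by (intro has_bochner_integral_prod) auto
      then have "has_bochner_integral ?Z (\<lambda>z. (\<Prod>k\<in>{0..n}. exp (\<alpha> k * x k)) * (\<Prod>k\<in>{1..n}. ?f k (z k)))
         ((\<Prod>k\<in>{0..n}. exp (\<alpha> k * x k)) * (\<Prod>k\<in>{1..n}. p_heat (e k) (x (k - 1)) (x k)))"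
        by (intro has_bochner_integral_mult_right)
      moreover have "(\<Prod>k\<in>{0..n}. exp (\<alpha> k * x k)) * (\<Prod>k\<in>{1..n}. ?f k (z k)) = ?A x z * ?W z" for z
        unfolding prod_vertex_weight prod.distrib by (simp only: mult_ac)
      ultimately show ?thesis by simp
    qed
    from has_bochner_integral_fst[OF psf hb this]
    show "has_bochner_integral ?X
      (\<lambda>x. (\<Prod>k\<in>{0..n}. exp (\<alpha> k * x k)) * (\<Prod>k\<in>{1..n}. p_heat (e k) (x (k - 1)) (x k))) ?v" .
    have "has_bochner_integral ?X (\<lambda>x. ?A x z * ?W z) ((\<Prod>k\<in>{0..n}. vertex_integral n \<alpha> k z) * ?W z)" for z
      by (intro has_bochner_integral_mult_left A)
    from has_bochner_integral_snd[OF psf hb this]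
    show "has_bochner_integral ?Z (\<lambda>z. (\<Prod>k\<in>{0..n}. vertex_integral n \<alpha> k z) * ?W z) ?v" .
  qed
qed

section \<open>Transition densities\<close>

text \<open>Makes one coordinate the outer variable, as required for the initial state of the dual
  process. The update map transports the binary product measure to the product over
  \<open>insert i I\<close>, so the pair version of Fubini applies.\<close>

lemma (in product_sigma_finite) has_bochner_integral_insert:
  fixes f :: "_ \<Rightarrow> _::{banach, second_countable_topology}"
  assumes I: "finite I" "i \<notin> I" and f: "has_bochner_integral (PiM (insert i I) M) f v"
  shows "has_bochner_integral (M i) (\<lambda>x. \<integral>y. f (y(i := x)) \<partial>PiM I M) v"
proof -
  interpret I: sigma_finite_measure "PiM I M" by (rule sigma_finite[OF I(1)])
  interpret P: pair_sigma_finite "M i" "PiM I M" ..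
  let ?u = "\<lambda>(x, y). y(i := x)"
  have u[measurable]: "?u \<in> M i \<Otimes>\<^sub>M PiM I M \<rightarrow>\<^sub>M PiM (insert i I) M"
    unfolding case_prod_beta' by (rule measurable_fun_upd[where J=I]) auto
  have eq: "distr (M i \<Otimes>\<^sub>M PiM I M) (PiM (insert i I) M) ?u = PiM (insert i I) M"
  proof (rule measure_eqI)
    fix B assume "B \<in> sets (distr (M i \<Otimes>\<^sub>M PiM I M) (PiM (insert i I) M) ?u)"
    then have [measurable]: "B \<in> sets (PiM (insert i I) M)" by simp
    have "emeasure (distr (M i \<Otimes>\<^sub>M PiM I M) (PiM (insert i I) M) ?u) B =
        (\<integral>\<^sup>+p. indicator B (?u p) \<partial>(M i \<Otimes>\<^sub>M PiM I M))"
      by (subst nn_integral_indicator[symmetric], simp, subst nn_integral_distr) auto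
    also have "\<dots> = (\<integral>\<^sup>+x. \<integral>\<^sup>+y. indicator B (y(i := x)) \<partial>PiM I M \<partial>M i)"
      by (subst I.nn_integral_fst[symmetric]) auto
    also have "\<dots> = emeasure (PiM (insert i I) M) B"
      by (subst product_nn_integral_insert_rev[OF I, symmetric]) auto
    finally show "emeasure (distr (M i \<Otimes>\<^sub>M PiM I M) (PiM (insert i I) M) ?u) B = emeasure (PiM (insert i I) M) B" .
  qed simp
  have "has_bochner_integral (M i \<Otimes>\<^sub>M PiM I M) (\<lambda>p. f (?u p)) v"
  proof -
    have [measurable]: "f \<in> borel_measurable (PiM (insert i I) M)"
      using f by (auto simp: has_bochner_integral_iff)
    have "has_bochner_integral (distr (M i \<Otimes>\<^sub>M PiM I M) (PiM (insert i I) M) ?u) f v"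
      using f by (simp only: eq)
    then show ?thesis
      unfolding has_bochner_integral_iff integrable_distr_eq[OF u \<open>f \<in> _\<close>] integral_distr[OF u \<open>f \<in> _\<close>] .
  qed
  then have i: "integrable (M i \<Otimes>\<^sub>M PiM I M) (\<lambda>(x, y). f (y(i := x)))"
    and v: "(\<integral>(x, y). f (y(i := x)) \<partial>(M i \<Otimes>\<^sub>M PiM I M)) = v"
    by (auto simp: has_bochner_integral_iff case_prod_beta')
  show ?thesis
    using P.integral_fst[OF i] P.integrable_fst[OF i] v by (simp add: has_bochner_integral_iff)
qed

section \<open>The transition density as a kernel times a quotient\<close>

lemma T_density_measurable [measurable (raw)]:
  assumes [measurable]: "f \<in> borel_measurable M" "g \<in> borel_measurable M"
  shows "(\<lambda>w. T_density c s t (f w) (g w)) \<in> borel_measurable M"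
  unfolding T_density_def by measurable

lemma T_density_nonneg: "s < t \<Longrightarrow> T_density c s t x y \<ge> 0"
  unfolding T_density_def by (auto intro!: divide_nonneg_nonneg mult_nonneg_nonneg Gamma_real_nonneg)

text \<open>The density has the shape of a Doob transform: a kernel conjugated by the function
  \<open>(cmod (Gamma ((c - s + \<i> * sqrt x) / 2)))\<^sup>2\<close> of time and state. The powers
  of 2 combine to the \<open>1/8\<close> of the definition.\<close>

lemma T_density_eq_Mellin_KK:
  assumes "s < t" "y > 0"
  shows "T_density c s t x y =
    (cmod (Gamma ((c - t + \<i> * sqrt y) / 2)))\<^sup>2 / (cmod (Gamma ((c - s + \<i> * sqrt x) / 2)))\<^sup>2 *
    (2 powr (s - t) * (Mellin_KK (t - s) (sqrt x) (sqrt y) * spectral_density y))"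
proof -
  define N where "N = (cmod (Gamma ((t - s + \<i> * (sqrt x + sqrt y)) / 2) * Gamma ((t - s + \<i> * (sqrt x - sqrt y)) / 2)))\<^sup>2"
  have p: "2 powr (s - t) * 2 powr (t - s - 3) = 1 / (8::real)"
    by (simp add: powr_minus flip: powr_add)
  have "2 powr (s - t) * (Mellin_KK (t - s) (sqrt x) (sqrt y) * spectral_density y) =
     (2 powr (s - t) * 2 powr (t - s - 3)) / Gamma (t - s) *
       (cmod (Gamma ((t - s + \<i> * (sqrt x + sqrt y)) / 2) * Gamma ((t - s + \<i> * (sqrt x - sqrt y)) / 2)))\<^sup>2 *
       spectral_density y"
    by (simp add: Mellin_KK_def)
  also have "\<dots> = N / (8 * Gamma (t - s)) * (1 / (pi * sqrt y * (cmod (Gamma (\<i> * sqrt y)))\<^sup>2))"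
    unfolding p spectral_density_def N_def using \<open>y > 0\<close> by simp
  finally show ?thesis
    using \<open>y > 0\<close> by (simp add: T_density_def norm_mult power_mult_distrib N_def mult_ac)
qed

text \<open>The quotients \<open>G k / G (k + 1)\<close> telescope. The bound
  \<open>s (d + 1) < c\<close> travels through the induction because it keeps the cancelled factors
  nonzero.\<close>

lemma prod_T_density:
  fixes s z :: "nat \<Rightarrow> real"
  assumes pos: "\<forall>k\<in>{1..d + 1}. z k > 0"
    and s: "\<forall>k\<in>{1..d}. s (k + 1) < s k" and c: "s 1 < c"
  defines "G \<equiv> \<lambda>k. (cmod (Gamma ((c - s k + \<i> * sqrt (z k)) / 2)))\<^sup>2"
  shows "(\<Prod>k=1..d. T_density c (s (k + 1)) (s k) (z (k + 1)) (z k)) =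
    G 1 / G (d + 1) * (2 powr (s (d + 1) - s 1) *
      (\<Prod>k=1..d. Mellin_KK (s k - s (k + 1)) (sqrt (z (k + 1))) (sqrt (z k)) * spectral_density (z k)))
    \<and> s (d + 1) < c"
  using pos s
proof (induction d)
  case 0
  \<comment> \<open>The quotient \<open>G 1 / G 1\<close> must be 1. \<open>Gamma\<close> takes the
    value 0 only at the nonpositive integers, its default at the poles, and the argument has
    positive real part.\<close>
  have "(c - s 1 + \<i> * sqrt (z 1)) / 2 \<notin> \<int>\<^sub>\<le>\<^sub>0"
    using c by (auto elim!: nonpos_Ints_cases simp: complex_eq_iff)
  then have "G 1 \<noteq> 0" by (simp add: G_def Gamma_eq_zero_iff)
  then show ?case using c by simp
next
  case (Suc d)
  have IH: "(\<Prod>k=1..d. T_density c (s (k + 1)) (s k) (z (k + 1)) (z k)) =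
      G 1 / G (d + 1) * (2 powr (s (d + 1) - s 1) *
        (\<Prod>k=1..d. Mellin_KK (s k - s (k + 1)) (sqrt (z (k + 1))) (sqrt (z k)) * spectral_density (z k)))"
    and lt: "s (d + 1) < c"
    using Suc by auto
  have lt': "s (d + 2) < s (d + 1)" using Suc.prems(2) by simp
  have "(c - s (d + 1) + \<i> * sqrt (z (d + 1))) / 2 \<notin> \<int>\<^sub>\<le>\<^sub>0"
    using lt by (auto elim!: nonpos_Ints_cases simp: complex_eq_iff)
  then have G: "G (d + 1) \<noteq> 0" by (simp add: G_def Gamma_eq_zero_iff)
  let ?T = "\<lambda>k. T_density c (s (k + 1)) (s k) (z (k + 1)) (z k)"
  let ?E = "\<lambda>k. Mellin_KK (s k - s (k + 1)) (sqrt (z (k + 1))) (sqrt (z k)) * spectral_density (z k)"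
  have p: "(2::real) powr (s (d + 2) - s 1) = 2 powr (s (d + 1) - s 1) * 2 powr (s (d + 2) - s (d + 1))"
    by (simp flip: powr_add)
  have T: "?T (d + 1) = G (d + 1) / G (d + 2) * (2 powr (s (d + 2) - s (d + 1)) * ?E (d + 1))"
    using T_density_eq_Mellin_KK[OF lt', of "z (d + 1)" c "z (d + 2)"] Suc.prems(1)
    by (simp add: G_def)
  have alg: "x / g * (p * P) * (g / y * (q * E)) = x / y * (p * q * (P * E))"
    if "g \<noteq> 0" for x y g p q P E :: real
    using that by simp
  have "prod ?T {1..d + 1} = prod ?T {1..d} * ?T (d + 1)" by simp
  also have "\<dots> = G 1 / G (d + 2) * (2 powr (s (d + 2) - s 1) * (prod ?E {1..d} * ?E (d + 1)))"
    unfolding IH T p by (rule alg[OF G])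
  also have "prod ?E {1..d} * ?E (d + 1) = prod ?E {1..d + 1}" by simp
  finally have "prod ?T {1..d + 1} = G 1 / G (d + 2) * (2 powr (s (d + 2) - s 1) * prod ?E {1..d + 1})" .
  moreover have "s (d + 2) < c" using lt lt' by simp
  moreover have "d + 1 = Suc d" "d + 2 = Suc d + 1" by simp_all
  ultimately show ?case by (simp only:)
qed

text \<open>Abel summation with the boundary terms kept on the left, so that each coefficient on the
  right is a difference of consecutive values of \<open>S\<close>.\<close>

lemma sum_by_parts_increments:
  fixes x S :: "nat \<Rightarrow> real"
  shows "S 0 * x 0 + (\<Sum>k=1..n. S k * (x k - x (k - 1))) - S (n + 1) * x n =
    (\<Sum>k\<in>{0..n}. (S k - S (k + 1)) * x k)"
  by (induction n) (auto simp: algebra_simps)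

lemma has_bochner_integral_has_real_density:
  fixes g :: "'b \<Rightarrow> real"
  assumes X: "has_real_density M N X f" and [measurable]: "g \<in> borel_measurable N"
    and fg: "has_bochner_integral N (\<lambda>x. f x * g x) v"
  shows "has_bochner_integral M (\<lambda>\<omega>. g (X \<omega>)) v"
proof -
  \<comment> \<open>The density \<open>f\<close> is nonnegative only almost everywhere, and only its
    \<open>ennreal\<close> image is known to be measurable. The truncation \<open>f'\<close> is
    measurable, nonnegative everywhere and almost everywhere equal to \<open>f\<close>.\<close>
  define f' where "f' x = enn2real (ennreal (f x))" for x
  have nn: "AE x in N. 0 \<le> f x" and D: "distributed M N X (\<lambda>x. ennreal (f x))"
    using X by (auto simp: has_real_density_def)
  have [measurable]: "(\<lambda>x. ennreal (f x)) \<in> borel_measurable N"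
    using D by (auto simp: distributed_def)
  have [measurable]: "f' \<in> borel_measurable N" unfolding f'_def by measurable
  have f'_nn: "0 \<le> f' x" for x by (simp add: f'_def)
  have "ennreal (f' x) = ennreal (f x)" for x by (simp add: f'_def)
  then have D': "distributed M N X (\<lambda>x. ennreal (f' x))" using D by (simp only:)
  have ae: "AE x in N. f x * g x = f' x * g x"
    using nn by eventually_elim (simp add: f'_def)
  have "(\<lambda>x. f x * g x) \<in> borel_measurable N" using fg by (auto simp: has_bochner_integral_iff)
  then have "has_bochner_integral N (\<lambda>x. f' x * g x) v"
    using fg has_bochner_integral_cong_AE[OF _ _ ae] by auto
  then show ?thesis
    using distributed_integrable[OF D', of g] distributed_integral[OF D', of g] f'_nn
    by (simp add: has_bochner_integral_iff)
qed

section \<open>Identification of both sides with the two orders of integration\<close>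

theorem theorem1p2:
  fixes \<tau> a c :: real and d :: nat and s t :: "nat \<Rightarrow> real"
    and M :: "'w measure" and Y :: "real \<Rightarrow> 'w \<Rightarrow> real"
  assumes "\<tau> > 0" and "a + c > 0"
    and "s 1 < c" and "\<forall>k\<in>{1..d}. s (k + 1) < s k" and "- a < s (d + 1)"
    and "t 0 = 0" and "\<forall>k\<in>{1..d+1}. t (k - 1) < t k" and "t (d + 1) = \<tau>"
    and "Y_process \<tau> a c M Y"
  shows "set_integrable lborel {0<..} (\<lambda>x.
           (\<integral>z. exp (- (\<Sum>k=1..d+1. (t k - t (k - 1)) * z k)) \<partial>T_law c d s x) *
           p_tilde \<tau> a c (s (d + 1)) x)
       \<and> integrable M (\<lambda>\<omega>. exp (\<Sum>k=1..d+1. s k * (Y (t k) \<omega> - Y (t (k - 1)) \<omega>)))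
       \<and> (LBINT x:{0<..}.
           (\<integral>z. exp (- (\<Sum>k=1..d+1. (t k - t (k - 1)) * z k)) \<partial>T_law c d s x) *
           p_tilde \<tau> a c (s (d + 1)) x)
         = (\<integral>\<omega>. exp (\<Sum>k=1..d+1. s k * (Y (t k) \<omega> - Y (t (k - 1)) \<omega>)) \<partial>M)"
proof -
  \<comment> \<open>The boundary values \<open>S 0 = c\<close> and \<open>S (d + 2) = - a\<close> absorb the factor \<open>exp (c x\<^sub>0 + a x\<^bsub>d+1\<^esub>)\<close>.\<close>
  define n where "n = d + 1"
  define S where "S k = (if k = 0 then c else if k = d + 2 then - a else s k)" for k
  define \<alpha> where "\<alpha> k = S k - S (k + 1)" for k
  define e where "e k = t k - t (k - 1)" for k
  define C where "C = C_norm \<tau> a c"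
  note sd = assms(4)[rule_format]
  have n: "n \<ge> 1" by (simp add: n_def)
  \<comment> \<open>The Mellin exponents are positive by the ordering
    \<open>c > s 1 > ... > s (d + 1) > - a\<close>; at the ends they are \<open>c - s 1\<close> and
    \<open>a + s (d + 1)\<close>.\<close>
  have \<alpha>: "\<alpha> k > 0" if "k \<le> n" for k
    using that assms(3,5) sd[of k] by (auto simp: \<alpha>_def S_def n_def)
  have e: "e k > 0" if "k \<in> {1..n}" for k
    using assms(7) that by (auto simp: e_def n_def)
  obtain v where
    v1: "has_bochner_integral (PiM {0..n} (\<lambda>_. lborel))
      (\<lambda>x. (\<Prod>k\<in>{0..n}. exp (\<alpha> k * x k)) * (\<Prod>k\<in>{1..n}. p_heat (e k) (x (k - 1)) (x k))) v" and
    v2: "has_bochner_integral (PiM {1..n} (\<lambda>_. lborel))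
      (\<lambda>z. (\<Prod>k\<in>{0..n}. vertex_integral n \<alpha> k z) * (\<Prod>k\<in>{1..n}. exp (- (e k * z k)) * spectral_density (z k))) v"
    by (rule heat_chain_duality[of n \<alpha> e, OF n \<alpha> e])

  have Y: "has_bochner_integral M (\<lambda>\<omega>. exp (\<Sum>k=1..d+1. s k * (Y (t k) \<omega> - Y (t (k - 1)) \<omega>))) (1 / C * v)"
  proof -
    let ?N = "PiM {0..d+1} (\<lambda>_. lborel :: real measure)"
    let ?X = "\<lambda>\<omega>. \<lambda>k\<in>{0..d+1}. Y (t k) \<omega>"
    define f where "f x = 1 / C * exp (c * x 0 + a * x (d + 1)) *
               (\<Prod>k=1..d+1. p_heat (t k - t (k - 1)) (x (k - 1)) (x k))" for x
    define g where "g x = exp (\<Sum>k=1..d+1. s k * (x k - x (k - 1)))" for x :: "nat \<Rightarrow> real"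
    have D: "has_real_density M ?N ?X f"
      using assms(9)[unfolded Y_process_def, THEN conjunct2, THEN conjunct2, THEN spec[of _ d],
          THEN spec[of _ t], THEN mp, OF conjI[OF assms(6) conjI[OF assms(7,8)]]]
      unfolding f_def C_def .
    have g: "g \<in> borel_measurable ?N"
      unfolding g_def by (intro measurable_compose[OF _ borel_measurable_exp] borel_measurable_sum) auto
    have "has_bochner_integral ?N (\<lambda>x. 1 / C * ((\<Prod>k\<in>{0..n}. exp (\<alpha> k * x k)) * (\<Prod>k\<in>{1..n}. p_heat (e k) (x (k - 1)) (x k)))) (1 / C * v)"
      using v1 unfolding n_def by (intro has_bochner_integral_mult_right)
    moreover have "1 / C * ((\<Prod>k\<in>{0..n}. exp (\<alpha> k * x k)) * (\<Prod>k\<in>{1..n}. p_heat (e k) (x (k - 1)) (x k))) = f x * g x" for x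
    proof -
      have "(\<Sum>k=1..n. S k * (x k - x (k - 1))) = (\<Sum>k=1..n. s k * (x k - x (k - 1)))"
        by (intro sum.cong) (auto simp: S_def n_def)
      \<comment> \<open>The boundary terms \<open>S 0 * x 0\<close> and
        \<open>- S (n + 1) * x n\<close> are \<open>c * x 0\<close> and
        \<open>a * x n\<close>.\<close>
      then have "(\<Sum>k\<in>{0..n}. \<alpha> k * x k) = c * x 0 + a * x n + (\<Sum>k=1..n. s k * (x k - x (k - 1)))"
        using sum_by_parts_increments[of S x n] by (simp add: \<alpha>_def S_def n_def)
      then have "(\<Prod>k\<in>{0..n}. exp (\<alpha> k * x k)) = exp (c * x 0 + a * x n) * g x"
        by (simp only: g_def n_def flip: exp_sum[OF finite_atLeastAtMost] exp_add)
      then show ?thesis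
        by (simp only: f_def e_def n_def mult_ac)
    qed
    ultimately have fg: "has_bochner_integral ?N (\<lambda>x. f x * g x) (1 / C * v)"
      by (simp only:)
    have "has_bochner_integral M (\<lambda>\<omega>. g (?X \<omega>)) (1 / C * v)"
      by (rule has_bochner_integral_has_real_density[OF D g fg])
    moreover have "g (?X \<omega>) = exp (\<Sum>k=1..d+1. s k * (Y (t k) \<omega> - Y (t (k - 1)) \<omega>))" for \<omega>
      unfolding g_def by (intro arg_cong[where f=exp] sum.cong) auto
    ultimately show ?thesis by (simp only:)
  qed

  \<comment> \<open>The integrand of the left-hand side on the space of all \<open>d + 1\<close>
    states. Only the initial state needs an explicit indicator, as \<open>T_density\<close> is 0 at
    nonpositive targets.\<close>
  define Q where "Q z = (\<Prod>k=1..d. T_density c (s (k + 1)) (s k) (z (k + 1)) (z k)) *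
      exp (- (\<Sum>k=1..d+1. e k * z k)) * (indicator {0<..} (z (d + 1)) * p_tilde \<tau> a c (s (d + 1)) (z (d + 1)))"
    for z
  \<comment> \<open>The identity is pointwise. If some coordinate is nonpositive both sides are 0:
    the right through \<open>spectral_density\<close>, the left through a transition density or the
    indicator.\<close>
  have Q: "Q z = 1 / C * ((\<Prod>k\<in>{0..n}. vertex_integral n \<alpha> k z) *
      (\<Prod>k\<in>{1..n}. exp (- (e k * z k)) * spectral_density (z k)))" for z
  proof (cases "\<forall>k\<in>{1..d+1}. z k > 0")
    case False
    then obtain k where k: "k \<in> {1..d+1}" "z k \<le> 0" by force
    have "(\<Prod>k\<in>{1..n}. exp (- (e k * z k)) * spectral_density (z k)) = 0"
    proof (rule prod_zero)
      show "\<exists>k\<in>{1..n}. exp (- (e k * z k)) * spectral_density (z k) = 0"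
        using k by (intro bexI[of _ k]) (simp_all add: spectral_density_def n_def)
    qed simp
    moreover have "Q z = 0"
    proof (cases "k = d + 1")
      case False
      have "(\<Prod>k=1..d. T_density c (s (k + 1)) (s k) (z (k + 1)) (z k)) = 0"
      proof (rule prod_zero)
        show "\<exists>k\<in>{1..d}. T_density c (s (k + 1)) (s k) (z (k + 1)) (z k) = 0"
          using k False by (intro bexI[of _ k]) (auto simp: T_density_def)
      qed simp
      then show ?thesis by (simp add: Q_def)
    qed (use k in \<open>simp add: Q_def\<close>)
    ultimately show ?thesis by simp
  next
    case True
    define G where "G k = (cmod (Gamma ((c - s k + \<i> * sqrt (z k)) / 2)))\<^sup>2" for k
    define E where "E k = Mellin_KK (s k - s (k + 1)) (sqrt (z (k + 1))) (sqrt (z k))" for k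
    define A where "A = (cmod (Gamma ((a + s (d + 1) + \<i> * sqrt (z (d + 1))) / 2)))\<^sup>2"
    have T: "(\<Prod>k=1..d. T_density c (s (k + 1)) (s k) (z (k + 1)) (z k)) =
        G 1 / G (d + 1) * (2 powr (s (d + 1) - s 1) * (\<Prod>k=1..d. E k * spectral_density (z k)))"
      and lt: "s (d + 1) < c"
      using prod_T_density[OF True assms(4,3)] unfolding G_def E_def by blast+
    have "(c - s (d + 1) + \<i> * sqrt (z (d + 1))) / 2 \<notin> \<int>\<^sub>\<le>\<^sub>0"
      using lt by (auto elim!: nonpos_Ints_cases simp: complex_eq_iff)
    then have G: "G (d + 1) \<noteq> 0" by (simp add: G_def Gamma_eq_zero_iff)
    \<comment> \<open>The factor \<open>G (d + 1)\<close> cancels the denominator left by the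
      telescoping product, while \<open>A\<close> is the contribution of the last vertex.\<close>
    have p: "p_tilde \<tau> a c (s (d + 1)) (z (d + 1)) =
        2 powr (a + c) / (16 * C) * (A * G (d + 1) * spectral_density (z (d + 1)))"
      using True by (simp add: p_tilde_def spectral_density_def A_def G_def C_def norm_mult power_mult_distrib)
    have "(\<Prod>k\<in>{0..n}. vertex_integral n \<alpha> k z) =
        vertex_integral n \<alpha> 0 z * (\<Prod>k=1..d. vertex_integral n \<alpha> k z) * vertex_integral n \<alpha> n z"
      by (simp add: n_def prod.atLeast_Suc_atMost)
    also have "(\<Prod>k=1..d. vertex_integral n \<alpha> k z) = (\<Prod>k=1..d. E k)"
      by (intro prod.cong) (auto simp: vertex_integral_def n_def E_def \<alpha>_def S_def)
    also have "vertex_integral n \<alpha> 0 z = 2 powr (c - s 1 - 2) * G 1"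
      by (simp add: vertex_integral_def \<alpha>_def S_def Mellin_K_def G_def)
    also have "vertex_integral n \<alpha> n z = 2 powr (a + s (d + 1) - 2) * A"
      by (simp add: vertex_integral_def \<alpha>_def S_def Mellin_K_def A_def n_def add.commute)
    finally have V: "(\<Prod>k\<in>{0..n}. vertex_integral n \<alpha> k z) =
        (2 powr (c - s 1 - 2) * 2 powr (a + s (d + 1) - 2)) * (G 1 * (\<Prod>k=1..d. E k) * A)"
      by (simp only: mult_ac)
    \<comment> \<open>The two end vertices supply the \<open>- 2\<close> twice;
      \<open>2 powr (- 4)\<close> is the \<open>1/16\<close> in \<open>p_tilde\<close>.\<close>
    have "(2::real) powr (c - s 1 - 2) * 2 powr (a + s (d + 1) - 2) =
        2 powr (s (d + 1) - s 1) * 2 powr (a + c) * 2 powr (- 4)"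
      by (simp add: algebra_simps flip: powr_add)
    then have P: "(2::real) powr (c - s 1 - 2) * 2 powr (a + s (d + 1) - 2) =
        2 powr (s (d + 1) - s 1) * 2 powr (a + c) / 16"
      by (simp add: powr_minus)
    have W: "(\<Prod>k\<in>{1..n}. exp (- (e k * z k)) * spectral_density (z k)) =
        exp (- (\<Sum>k=1..d+1. e k * z k)) * ((\<Prod>k=1..d. spectral_density (z k)) * spectral_density (z (d + 1)))"
    proof -
      have "exp (- (\<Sum>k=1..d+1. e k * z k)) = (\<Prod>k\<in>{1..n}. exp (- (e k * z k)))"
        by (simp only: n_def sum_negf[symmetric] exp_sum finite_atLeastAtMost)
      moreover have "(\<Prod>k\<in>{1..n}. spectral_density (z k)) = (\<Prod>k=1..d. spectral_density (z k)) * spectral_density (z (d + 1))"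
        by (simp add: n_def)
      ultimately show ?thesis by (simp only: prod.distrib)
    qed
    \<comment> \<open>Applied only to the occurrence of \<open>G 1\<close> on the right, so that
      both sides contain the same quotient and \<open>alg\<close> is a pure rearrangement.\<close>
    have q: "G 1 = (G 1 / G (d + 1)) * G (d + 1)" using G by simp
    have i: "indicator {0<..} (z (d + 1)) = (1::real)" using True by simp
    have alg: "q * (x * (y * r)) * w * (1 * (u / (16 * C) * (A * g * r'))) =
        1 / C * (x * u / 16 * (q * g * y * A) * (w * (r * r')))" for q x y r w u g r' :: real
      by (simp add: mult_ac)
    show ?thesis
      unfolding Q_def T[unfolded prod.distrib] p V P W i by (subst (2) q) (rule alg)
  qed

  interpret product_sigma_finite "\<lambda>_::nat. lborel :: real measure" ..
  \<comment> \<open>Coordinate \<open>d + 1\<close>, the state at the smallest time, becomes the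
    outer variable \<open>x\<close>.\<close>
  have ins: "insert (d + 1) {1..d} = {1..n}" by (auto simp: n_def)
  have "has_bochner_integral (PiM {1..n} (\<lambda>_. lborel)) Q (1 / C * v)"
    unfolding Q by (intro has_bochner_integral_mult_right v2)
  then have "has_bochner_integral (PiM (insert (d + 1) {1..d}) (\<lambda>_. lborel)) Q (1 / C * v)"
    unfolding ins .
  from has_bochner_integral_insert[OF _ _ this]
  have "has_bochner_integral lborel (\<lambda>x. \<integral>y. Q (y(d + 1 := x)) \<partial>PiM {1..d} (\<lambda>_. lborel)) (1 / C * v)"
    by simp
  \<comment> \<open>The remaining integral over the coordinates \<open>1..d\<close> is the
    conditional expectation under \<open>T_law\<close>; for \<open>d = 0\<close> it is taken over a
    one-point space.\<close>
  moreover have "(\<integral>y. Q (y(d + 1 := x)) \<partial>PiM {1..d} (\<lambda>_. lborel)) = indicator {0<..} x *\<^sub>R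
      ((\<integral>z. exp (- (\<Sum>k=1..d+1. (t k - t (k - 1)) * z k)) \<partial>T_law c d s x) * p_tilde \<tau> a c (s (d + 1)) x)" for x
  proof -
    let ?L = "PiM {1..d} (\<lambda>_. lborel :: real measure)"
    let ?B = "PiM {1..d+1} (\<lambda>_. borel :: real measure)"
    let ?T = "\<lambda>z. \<Prod>k=1..d. T_density c (s (k + 1)) (s k) (z (k + 1)) (z k)"
    let ?g = "\<lambda>z. exp (- (\<Sum>k=1..d+1. (t k - t (k - 1)) * z k))"
    have u[measurable]: "(\<lambda>y. y(d + 1 := x)) \<in> ?L \<rightarrow>\<^sub>M ?B"
    proof -
      have "(\<lambda>y. y(d + 1 := x)) \<in> ?L \<rightarrow>\<^sub>M PiM {1..d+1} (\<lambda>_. lborel)"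
        by (rule measurable_fun_upd[where J="{1..d}"]) (auto simp: measurable_ident_sets)
      also have "(?L \<rightarrow>\<^sub>M PiM {1..d+1} (\<lambda>_. lborel)) = (?L \<rightarrow>\<^sub>M ?B)"
        by (intro measurable_cong_sets sets_PiM_cong) auto
      finally show ?thesis .
    qed
    have g: "?g \<in> borel_measurable ?B"
      by (intro measurable_compose[OF _ borel_measurable_exp] borel_measurable_uminus borel_measurable_sum) auto
    have "?T \<in> borel_measurable ?B"
      by (intro borel_measurable_prod T_density_measurable) auto
    then have T: "(\<lambda>y. ?T (y(d + 1 := x))) \<in> borel_measurable ?L"
      by (rule measurable_compose[OF u])
    have "(\<integral>z. ?g z \<partial>T_law c d s x) =
      (\<integral>y. ?g (y(d + 1 := x)) \<partial>density ?L (\<lambda>y. ennreal (?T (y(d + 1 := x)))))"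
      unfolding T_law_def Let_def by (rule integral_distr[OF _ g], subst measurable_cong_sets[OF sets_density refl], rule u)
    also have "\<dots> = (\<integral>y. ?T (y(d + 1 := x)) *\<^sub>R ?g (y(d + 1 := x)) \<partial>?L)"
      by (intro integral_density measurable_compose[OF u g] T AE_I2 prod_nonneg T_density_nonneg ballI sd)
    finally have eq: "(\<integral>z. ?g z \<partial>T_law c d s x) = (\<integral>y. ?T (y(d + 1 := x)) *\<^sub>R ?g (y(d + 1 := x)) \<partial>?L)" .
    have Q': "Q (y(d + 1 := x)) = ?T (y(d + 1 := x)) *\<^sub>R ?g (y(d + 1 := x)) * (indicator {0<..} x * p_tilde \<tau> a c (s (d + 1)) x)" for y
      by (simp only: Q_def e_def fun_upd_same real_scaleR_def)
    \<comment> \<open>Pulling out the constant by \<open>integral_mult_left_zero\<close> carries no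
      integrability condition, so the identity holds at every \<open>x\<close>.\<close>
    show ?thesis
      unfolding eq Q' integral_mult_left_zero by (simp only: real_scaleR_def mult_ac)
  qed
  ultimately have "has_bochner_integral lborel (\<lambda>x. indicator {0<..} x *\<^sub>R
      ((\<integral>z. exp (- (\<Sum>k=1..d+1. (t k - t (k - 1)) * z k)) \<partial>T_law c d s x) * p_tilde \<tau> a c (s (d + 1)) x)) (1 / C * v)"
    by (simp only:)
  with Y show ?thesis
    unfolding set_integrable_def set_lebesgue_integral_def has_bochner_integral_iff by (simp only:)
qed

end
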